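(* Let $\delta\colon[0,\infty)\to[0,1)$ be a measurable function such that, for every $y_0\ge 0$, the ordinary differential equation $$y'(t)=1-\delta(y(t)),\quad t\ge 0,\qquad y(0)=y_0,$$ has a unique solution (a solution being an absolutely continuous function satisfying the equation for almost every $t$). Assume in addition that there exist $\epsilon>0$ and $\gamma\in[0,1)$ such that $\delta(x)=\gamma$ for all $x\in[0,\epsilon]$. Then for every càdlàg path $X=(X_t)_{t\ge0}$ with no positive jumps (i.e. $X_t-X_{t-}\le 0$ for all $t>0$) and every $\bar x\ge X_0\vee 0$, there exists a unique pair of càdlàg paths $(V^+,K^+)$ with $V^+_t\ge 0$ for all $t\ge0$ and $K^+$ (weakly) increasing, such that $$V^+_t=X_t+K^+_t-\int_{0^+}^t\delta(V^+_s)\,\mathrm d(\overline{X+K^+})_s,\qquad t\ge0,$$ and $$\int_0^\infty \mathbf 1_{\{V^+_t>0\}}\,\mathrm dK^+_t=0.$$ (This pair is called the tax-reflection transform of $X$ with tax rate $\delta$ and initial maximum level $\bar x$.)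
   Context: Running supremum: for a path $Y=(Y_t)_{t\ge0}$ and a number $\bar x\ge Y_0$, $\overline Y_t:=\bar x\vee\sup_{0\le s\le t}Y_s$ (the running supremum of $Y$ with initial maximum level $\bar x$); here $\overline{X+K^+}$ is the running supremum of $X+K^+$ with initial maximum level $\bar x$. Integral conventions: for measurable $f$ and increasing right-continuous $G$, $\int_{0^+}^t f(s)\,\mathrm dG(s)$ denotes the Stieltjes integral over $(0,t]$, and $\int_0^t f(s)\,\mathrm dG(s):=f(0)G(0)+\int_{0^+}^t f(s)\,\mathrm dG(s)$ (so an initial value $G(0)\neq 0$ counts as a mass at time $0$); $\int_0^\infty$ is defined analogously.
   Formalization: "Increasing" for K^+ is taken to include K^+_0 ≥ 0 (a nonnegative mass at time 0); without this uniqueness fails, e.g. for X ≡ 5 and initial maximum level 5, where both (5,0) and (0,−5) satisfy all the conditions. *)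

theory Defs
  imports "HOL-Analysis.Analysis"
begin

definition abs_cont_on_interval :: "real \<Rightarrow> real \<Rightarrow> (real \<Rightarrow> real) \<Rightarrow> bool" where
  "abs_cont_on_interval a b y \<longleftrightarrow>
     (\<forall>\<epsilon>>0. \<exists>d>0. \<forall>(n::nat) (l::nat \<Rightarrow> real) (r::nat \<Rightarrow> real).
        (\<forall>i<n. a \<le> l i \<and> l i \<le> r i \<and> r i \<le> b) \<and>
        (\<forall>i<n. \<forall>j<n. i \<noteq> j \<longrightarrow> r i \<le> l j \<or> r j \<le> l i) \<and>
        (\<Sum>i<n. r i - l i) < d
        \<longrightarrow> (\<Sum>i<n. \<bar>y (r i) - y (l i)\<bar>) < \<epsilon>)"

definition abs_cont_nonneg :: "(real \<Rightarrow> real) \<Rightarrow> bool" where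
  "abs_cont_nonneg y \<longleftrightarrow> (\<forall>T\<ge>0. abs_cont_on_interval 0 T y)"

text \<open>Solution of y' = 1 - delta(y), y(0) = y0 on [0,\<infinity>): absolutely continuous,
  with values in the domain [0,\<infinity>) of delta, satisfying the equation a.e.\<close>
definition ode_solution :: "(real \<Rightarrow> real) \<Rightarrow> real \<Rightarrow> (real \<Rightarrow> real) \<Rightarrow> bool" where
  "ode_solution \<delta> y0 y \<longleftrightarrow>
     abs_cont_nonneg y \<and> y 0 = y0 \<and> (\<forall>t\<ge>0. y t \<ge> 0) \<and>
     (AE t in lborel. t \<ge> 0 \<longrightarrow> (y has_real_derivative (1 - \<delta> (y t))) (at t))"

definition cadlag :: "(real \<Rightarrow> real) \<Rightarrow> bool" where
  "cadlag X \<longleftrightarrow> (\<forall>t\<ge>0. continuous (at_right t) X) \<and>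
                 (\<forall>t>0. \<exists>l. (X \<longlongrightarrow> l) (at_left t))"

definition no_pos_jumps :: "(real \<Rightarrow> real) \<Rightarrow> bool" where
  "no_pos_jumps X \<longleftrightarrow> (\<forall>t>0. X t - Lim (at_left t) X \<le> 0)"

definition runsup :: "real \<Rightarrow> (real \<Rightarrow> real) \<Rightarrow> real \<Rightarrow> real" where
  "runsup xbar Y t = max xbar (SUP s\<in>{0..max 0 t}. Y s)"

text \<open>Lebesgue-Stieltjes measure dG of an increasing right-continuous G on [0,\<infinity>),
  G extended constantly to the left of 0 (only used on subsets of (0,\<infinity>)).\<close>
definition LS_measure :: "(real \<Rightarrow> real) \<Rightarrow> real measure" where
  "LS_measure G = interval_measure (\<lambda>t. G (max 0 t))"

definition stieltjes_Ioc :: "(real \<Rightarrow> real) \<Rightarrow> (real \<Rightarrow> real) \<Rightarrow> real \<Rightarrow> real" where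
  "stieltjes_Ioc f G t = (LINT s:{0<..t}|LS_measure G. f s)"

definition stieltjes_nn_0_inf :: "(real \<Rightarrow> real) \<Rightarrow> (real \<Rightarrow> real) \<Rightarrow> ennreal" where
  "stieltjes_nn_0_inf f G =
     ennreal (f 0 * G 0) + (\<integral>\<^sup>+ s. indicator {0<..} s * ennreal (f s) \<partial>LS_measure G)"

definition tax_reflection :: "(real \<Rightarrow> real) \<Rightarrow> real \<Rightarrow> (real \<Rightarrow> real)
    \<Rightarrow> (real \<Rightarrow> real) \<Rightarrow> (real \<Rightarrow> real) \<Rightarrow> bool" where
  "tax_reflection \<delta> xbar X V K \<longleftrightarrow>
     cadlag V \<and> cadlag K \<and> (\<forall>t\<ge>0. V t \<ge> 0) \<and>
     mono_on {0..} K \<and> K 0 \<ge> 0 \<and>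
     (\<forall>t\<ge>0. V t = X t + K t
        - stieltjes_Ioc (\<lambda>s. \<delta> (V s)) (runsup xbar (\<lambda>s. X s + K s)) t) \<and>
     stieltjes_nn_0_inf (\<lambda>s. indicator {0<..} (V s)) K = 0"

end

theory Submission
  imports Defs
begin

text \<open>
  Write S for the running supremum of X + K, y for the solution of the ODE started at xbar,
  h z = y (z - xbar) and g z = z - h z. The measure dS is carried by the times at which X + K = S.
  At these times V equals U = S - (tax paid so far), which therefore satisfies dU = (1 - \<delta>(U)) dS;
  as the ODE is autonomous with a positive right-hand side, separation of variables gives U = h(S).
  Hence V = X + K - g(S), and the tax-reflection transform is the same as a pair (K, S) of running
  suprema, K of g(S) - X started at 0 and S of X + K started at xbar. Since h is strictly increasing,
  g is a strict contraction, which together with the continuity of S gives uniqueness. Since the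
  two equations are monotone in (K, S), the least supersolution solves them, and a supersolution
  exists on every compact interval because cadlag paths are uniform limits of step functions.
\<close>

text \<open>Since \<open>\<delta>\<close> may come arbitrarily close to 1, the contraction has no
  uniform factor; hence the order-theoretic construction instead of an iteration. Since
  \<open>\<delta>\<close> is merely measurable, separation of variables is done in integral form: U
  and h(S) agree because each is the level at which the integral of 1/(1 - \<open>\<delta>\<close>)
  from xbar reaches S - xbar. For h this needs the flow y to be the integral of its derivative,
  which is where absolute continuity enters.

  Continuity of S is the crux, for only then is the image of dS under S Lebesgue measure. For a pair
  of running suprema it comes from a feedback argument: X has no upward jumps, so S can jump only
  together with K; a jump of K lands on g(S) - X, whence S <= g(S), whereas g(z) < z for z > xbar.

  The two inequalities of a supersolution say X <= S - K <= X + h(S). So S - K only has to stay in a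
  band above X, and the width of the band is at least h(xbar + 1) > 0 as soon as S >= xbar + 1. A
  difference of two nondecreasing step functions fits into it.\<close>

section \<open>The fundamental theorem of calculus for absolutely continuous functions\<close>

lemma abs_cont_on_interval_subset:
  assumes "abs_cont_on_interval a b f" "a \<le> c" "d \<le> b"
  shows "abs_cont_on_interval c d f"
  unfolding abs_cont_on_interval_def
proof (intro allI impI)
  fix e :: real assume e: "e > 0"
  obtain \<eta> where \<eta>: "\<eta> > 0" "\<forall>(n::nat) (l::nat \<Rightarrow> real) (r::nat \<Rightarrow> real).
        (\<forall>i<n. a \<le> l i \<and> l i \<le> r i \<and> r i \<le> b) \<and>
        (\<forall>i<n. \<forall>j<n. i \<noteq> j \<longrightarrow> r i \<le> l j \<or> r j \<le> l i) \<and>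
        (\<Sum>i<n. r i - l i) < \<eta>
        \<longrightarrow> (\<Sum>i<n. \<bar>f (r i) - f (l i)\<bar>) < e"
    using assms(1)[unfolded abs_cont_on_interval_def, rule_format, OF e] by (elim exE conjE)
  show "\<exists>\<eta>>0. \<forall>(n::nat) (l::nat \<Rightarrow> real) (r::nat \<Rightarrow> real).
        (\<forall>i<n. c \<le> l i \<and> l i \<le> r i \<and> r i \<le> d) \<and>
        (\<forall>i<n. \<forall>j<n. i \<noteq> j \<longrightarrow> r i \<le> l j \<or> r j \<le> l i) \<and>
        (\<Sum>i<n. r i - l i) < \<eta>
        \<longrightarrow> (\<Sum>i<n. \<bar>f (r i) - f (l i)\<bar>) < e"
  proof (intro exI[of _ \<eta>] conjI \<eta>(1) allI impI)
    fix n :: nat and l r :: "nat \<Rightarrow> real"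
    assume "(\<forall>i<n. c \<le> l i \<and> l i \<le> r i \<and> r i \<le> d) \<and>
        (\<forall>i<n. \<forall>j<n. i \<noteq> j \<longrightarrow> r i \<le> l j \<or> r j \<le> l i) \<and> (\<Sum>i<n. r i - l i) < \<eta>"
    then show "(\<Sum>i<n. \<bar>f (r i) - f (l i)\<bar>) < e"
      using assms(2,3) by (intro \<eta>(2)[rule_format]) (auto intro: order_trans)
  qed
qed

text \<open>Reindexing from initial segments of the naturals to arbitrary finite sets, so that a
  tagged division can serve as its own index set.\<close>

lemma abs_cont_on_intervalD_finite:
  fixes f :: "real \<Rightarrow> real"
  assumes "abs_cont_on_interval a b f" "e > 0"
  shows "\<exists>d>0. \<forall>(I :: 'i set) l r. finite I \<and> (\<forall>i\<in>I. a \<le> l i \<and> l i \<le> r i \<and> r i \<le> b) \<and>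
       (\<forall>i\<in>I. \<forall>j\<in>I. i \<noteq> j \<longrightarrow> r i \<le> l j \<or> r j \<le> l i) \<and> (\<Sum>i\<in>I. r i - l i) < d
     \<longrightarrow> (\<Sum>i\<in>I. \<bar>f (r i) - f (l i)\<bar>) < e"
proof -
  obtain d where "d > 0" and d: "\<forall>(n::nat) (l::nat \<Rightarrow> real) (r::nat \<Rightarrow> real).
        (\<forall>i<n. a \<le> l i \<and> l i \<le> r i \<and> r i \<le> b) \<and>
        (\<forall>i<n. \<forall>j<n. i \<noteq> j \<longrightarrow> r i \<le> l j \<or> r j \<le> l i) \<and>
        (\<Sum>i<n. r i - l i) < d
        \<longrightarrow> (\<Sum>i<n. \<bar>f (r i) - f (l i)\<bar>) < e"
    using assms(1)[unfolded abs_cont_on_interval_def, rule_format, OF \<open>e > 0\<close>] by (elim exE conjE)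
  show ?thesis
  proof (intro exI[of _ d] conjI \<open>d > 0\<close> allI impI, elim conjE)
    fix I :: "'i set" and l r
    assume fin: "finite I" and 1: "\<forall>i\<in>I. a \<le> l i \<and> l i \<le> r i \<and> r i \<le> b"
      and 2: "\<forall>i\<in>I. \<forall>j\<in>I. i \<noteq> j \<longrightarrow> r i \<le> l j \<or> r j \<le> l i"
      and 3: "(\<Sum>i\<in>I. r i - l i) < d"
    obtain h where h: "bij_betw h {..<card I} I"
      using ex_bij_betw_nat_finite[OF fin] by (auto simp: atLeast0LessThan)
    have hI: "h i \<in> I" if "i < card I" for i
      using h that by (auto simp: bij_betw_def)
    have inj: "h i \<noteq> h j" if "i < card I" "j < card I" "i \<noteq> j" for i j
      using h that by (auto simp: bij_betw_def inj_on_def)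
    have "(\<Sum>i<card I. \<bar>f (r (h i)) - f (l (h i))\<bar>) < e"
    proof (rule d[rule_format], intro conjI allI impI)
      show "(\<Sum>i<card I. r (h i) - l (h i)) < d"
        using sum.reindex_bij_betw[OF h, of "\<lambda>i. r i - l i"] 3 by simp
    qed (use 1 hI in blast, use 1 hI in blast, use 1 hI in blast, use 2 hI inj in blast)
    then show "(\<Sum>i\<in>I. \<bar>f (r i) - f (l i)\<bar>) < e"
      using sum.reindex_bij_betw[OF h, of "\<lambda>i. \<bar>f (r i) - f (l i)\<bar>"] by simp
  qed
qed

text \<open>Outer regularity encloses the null set in an open U of measure below the modulus d.
  Intervals inside U with disjoint interiors then have total length below d, and absolute continuity
  bounds the variation over them.\<close>

lemma abs_cont_sum_fine_lt:
  fixes f :: "real \<Rightarrow> real"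
  assumes ac: "abs_cont_on_interval a b f" and "e > 0" and N: "negligible N"
  obtains U where "open U" "N \<subseteq> U"
    "\<And>q. \<lbrakk>q tagged_partial_division_of {a..b}; \<And>x K. (x, K) \<in> q \<Longrightarrow> K \<subseteq> U\<rbrakk>
       \<Longrightarrow> (\<Sum>(x, K)\<in>q. \<bar>f (Sup K) - f (Inf K)\<bar>) < e"
proof -
  obtain d where "d > 0" and d: "\<forall>(I :: (real \<times> real set) set) l r. finite I \<and>
       (\<forall>i\<in>I. a \<le> l i \<and> l i \<le> r i \<and> r i \<le> b) \<and>
       (\<forall>i\<in>I. \<forall>j\<in>I. i \<noteq> j \<longrightarrow> r i \<le> l j \<or> r j \<le> l i) \<and> (\<Sum>i\<in>I. r i - l i) < d
     \<longrightarrow> (\<Sum>i\<in>I. \<bar>f (r i) - f (l i)\<bar>) < e"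
    using abs_cont_on_intervalD_finite[OF ac \<open>e > 0\<close>] by (elim exE conjE)
  have N0: "N \<in> null_sets lebesgue"
    using N by (simp add: negligible_iff_null_sets)
  then obtain U where U: "open U" "N \<subseteq> U" "U - N \<in> lmeasurable" "emeasure lebesgue (U - N) < ennreal d"
    using sets_lebesgue_outer_open[of N d] \<open>d > 0\<close> by blast
  have eU: "emeasure lborel U < ennreal d"
  proof -
    have "U = (U - N) \<union> N" using U(2) by auto
    then have "emeasure lebesgue U = emeasure lebesgue ((U - N) \<union> N)" by simp
    also have "\<dots> = emeasure lebesgue (U - N)"
      using U(3) N0 by (intro emeasure_Un_null_set) (auto simp: fmeasurable_def)
    finally have "emeasure lebesgue U = emeasure lebesgue (U - N)" .
    then show ?thesis using U by simp
  qed
  show ?thesis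
  proof (rule that[OF U(1,2)])
    fix q assume q: "q tagged_partial_division_of {a..b}" and qU: "\<And>x K. (x, K) \<in> q \<Longrightarrow> K \<subseteq> U"
    \<comment> \<open>Degenerate intervals add nothing to the sum but must go: their interior is
      empty, so disjoint interiors would not keep them from lying inside another interval of the
      family.\<close>
    define q' where "q' = {(x, K) \<in> q. interior K \<noteq> {}}"
    note qD = tagged_partial_division_ofD[OF q]
    have fin: "finite q" "finite q'"
      using qD(1) by (auto simp: q'_def intro: finite_subset)
    have K: "\<exists>u v. K = {u..v} \<and> u \<le> v \<and> a \<le> u \<and> v \<le> b" if xK: "(x, K) \<in> q" for x K
    proof -
      obtain u v where "K = {u..v}" using qD(4)[OF xK] by auto
      then show ?thesis using qD(2,3)[OF xK] by auto
    qed
    have K': "\<exists>u v. K = {u..v} \<and> u < v \<and> a \<le> u \<and> v \<le> b" if "(x, K) \<in> q'" for x K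
      using K[of x K] that by (auto simp: q'_def)
    have disj: "interior K1 \<inter> interior K2 = {}" if "(x1, K1) \<in> q" "(x2, K2) \<in> q" "(x1, K1) \<noteq> (x2, K2)"
      for x1 K1 x2 K2 using qD(5) that by blast
    have "(\<Sum>(x, K)\<in>q. \<bar>f (Sup K) - f (Inf K)\<bar>) = (\<Sum>(x, K)\<in>q'. \<bar>f (Sup K) - f (Inf K)\<bar>)"
    proof (rule sum.mono_neutral_right)
      show "\<forall>i\<in>q - q'. (case i of (x, K) \<Rightarrow> \<bar>f (Sup K) - f (Inf K)\<bar>) = 0"
        using K by (fastforce simp: q'_def)
    qed (use fin in \<open>auto simp: q'_def\<close>)
    also have "\<dots> = (\<Sum>i\<in>q'. \<bar>f (Sup (snd i)) - f (Inf (snd i))\<bar>)"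
      by (simp add: case_prod_beta)
    also have "\<dots> < e"
    proof (rule d[rule_format], intro conjI fin(2) ballI impI)
      fix i assume "i \<in> q'"
      then show "a \<le> Inf (snd i)" "Inf (snd i) \<le> Sup (snd i)" "Sup (snd i) \<le> b"
        using K'[of "fst i" "snd i"] by auto
    next
      fix i j assume ij: "i \<in> q'" "j \<in> q'" "i \<noteq> j"
      obtain u v where 1: "snd i = {u..v}" "u < v" using K'[of "fst i" "snd i"] ij by auto
      obtain u' v' where 2: "snd j = {u'..v'}" "u' < v'" using K'[of "fst j" "snd j"] ij by auto
      have "{u<..<v} \<inter> {u'<..<v'} = {}"
        using disj[of "fst i" "snd i" "fst j" "snd j"] ij 1 2
        by (auto simp: q'_def prod_eq_iff)
      then have "v \<le> u' \<or> v' \<le> u"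
      proof (rule contrapos_pp)
        assume "\<not> (v \<le> u' \<or> v' \<le> u)"
        then have "(max u u' + min v v') / 2 \<in> {u<..<v} \<inter> {u'<..<v'}"
          using 1 2 by (auto simp: max_def min_def field_simps)
        then show "{u<..<v} \<inter> {u'<..<v'} \<noteq> {}" by blast
      qed
      then show "Sup (snd i) \<le> Inf (snd j) \<or> Sup (snd j) \<le> Inf (snd i)"
        using 1 2 by simp
    next
      have "ennreal (\<Sum>i\<in>q'. Sup (snd i) - Inf (snd i)) = (\<Sum>i\<in>q'. ennreal (Sup (snd i) - Inf (snd i)))"
        by (rule sum_ennreal[symmetric]) (use K' in fastforce)
      also have "\<dots> = (\<Sum>i\<in>q'. emeasure lborel (interior (snd i)))"
      proof (rule sum.cong[OF refl])
        fix i assume "i \<in> q'"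
        then obtain u v where "snd i = {u..v}" "u < v" using K'[of "fst i" "snd i"] by auto
        then show "ennreal (Sup (snd i) - Inf (snd i)) = emeasure lborel (interior (snd i))"
          by simp
      qed
      also have "\<dots> = emeasure lborel (\<Union>i\<in>q'. interior (snd i))"
      proof (rule sum_emeasure)
        show "disjoint_family_on (\<lambda>i. interior (snd i)) q'"
          unfolding disjoint_family_on_def
        proof (intro ballI impI)
          fix i j assume "i \<in> q'" "j \<in> q'" "i \<noteq> j"
          then show "interior (snd i) \<inter> interior (snd j) = {}"
            using disj[of "fst i" "snd i" "fst j" "snd j"] by (auto simp: q'_def prod_eq_iff)
        qed
      qed (use fin in auto)
      also have "\<dots> \<le> emeasure lborel U"
        using qU interior_subset U(1) by (intro emeasure_mono) (fastforce simp: q'_def)+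
      also have "\<dots> < ennreal d" by (rule eU)
      finally show "(\<Sum>i\<in>q'. Sup (snd i) - Inf (snd i)) < d"
        by (metis ennreal_leI linorder_not_less)
    qed
    finally show "(\<Sum>(x, K)\<in>q. \<bar>f (Sup K) - f (Inf K)\<bar>) < e" .
  qed
qed

text \<open>Henstock-Kurzweil argument with a gauge of two kinds. At tags off N the derivative gives
  the straddle estimate, with error proportional to the length of the interval. At tags in N, where
  the integrand is reset to 0, the gauge is the open set U of \<open>abs_cont_sum_fine_lt\<close>,
  which makes the total increment of f over those intervals small.\<close>

theorem fundamental_theorem_of_calculus_abs_cont:
  fixes f :: "real \<Rightarrow> real"
  assumes "a \<le> b" and ac: "abs_cont_on_interval a b f" and N: "negligible N"
    and der: "\<And>x. x \<in> {a..b} - N \<Longrightarrow> (f has_real_derivative f' x) (at x within {a..b})"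
  shows "(f' has_integral (f b - f a)) {a..b}"
proof -
  define g where "g x = (if x \<in> N then 0 else f' x)" for x
  have "(g has_integral (f b - f a)) {a..b}"
    unfolding has_integral_real
  proof (intro allI impI)
    fix e :: real assume "e > 0"
    \<comment> \<open>One half of e pays for the straddle errors, which sum to
      \<open>e' * (b - a)\<close>, the other half for the tags in N. The \<open>+ 1\<close> keeps
      the denominator positive when a = b.\<close>
    define e' where "e' = e / (2 * (b - a + 1))"
    have "e' > 0" using \<open>e > 0\<close> \<open>a \<le> b\<close> by (simp add: e'_def)
    have e'2: "e' * (b - a) < e / 2"
    proof -
      have "e' * (b - a) < e' * (b - a + 1)" using \<open>e' > 0\<close> by simp
      also have "\<dots> = e / 2" using \<open>a \<le> b\<close> by (simp add: e'_def field_simps)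
      finally show ?thesis .
    qed
    obtain U where U: "open U" "N \<subseteq> U"
      "\<And>q. \<lbrakk>q tagged_partial_division_of {a..b}; \<And>x K. (x, K) \<in> q \<Longrightarrow> K \<subseteq> U\<rbrakk>
         \<Longrightarrow> (\<Sum>(x, K)\<in>q. \<bar>f (Sup K) - f (Inf K)\<bar>) < e / 2"
      using \<open>e > 0\<close> by (auto intro: abs_cont_sum_fine_lt[OF ac _ N, of "e / 2"])
    have "\<forall>x. \<exists>d>0. x \<in> {a..b} - N \<longrightarrow>
         (\<forall>y\<in>{a..b}. norm (y-x) < d \<longrightarrow> norm (f y - f x - (y-x) *\<^sub>R f' x) \<le> e' * norm (y-x))"
      using der[unfolded has_real_derivative_iff_has_vector_derivative has_vector_derivative_def has_derivative_within_alt]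
        \<open>e' > 0\<close> by (intro allI) (metis zero_less_one)
    then obtain d where d: "\<And>x. 0 < d x"
      "\<And>x y. \<lbrakk>x \<in> {a..b} - N; y \<in> {a..b}; norm (y-x) < d x\<rbrakk>
             \<Longrightarrow> norm (f y - f x - (y-x) *\<^sub>R f' x) \<le> e' * norm (y-x)"
      by metis
    define \<gamma> where "\<gamma> x = (if x \<in> N then U else ball x (d x))" for x
    show "\<exists>\<gamma>. gauge \<gamma> \<and> (\<forall>\<D>. \<D> tagged_division_of {a..b} \<and> \<gamma> fine \<D> \<longrightarrow>
        norm ((\<Sum>(x,k)\<in>\<D>. measure lborel k *\<^sub>R g x) - (f b - f a)) < e)"
    proof (intro exI conjI allI impI; (elim conjE)?)
      show "gauge \<gamma>" using U d(1) by (auto simp: gauge_def \<gamma>_def)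
      fix p assume ptag: "p tagged_division_of {a..b}" and fine: "\<gamma> fine p"
      note pD = tagged_division_ofD[OF ptag]
      have ba: "b - a = (\<Sum>(x,K)\<in>p. Sup K - Inf K)" "f b - f a = (\<Sum>(x,K)\<in>p. f(Sup K) - f(Inf K))"
        using additive_tagged_division_1[where f= "\<lambda>x. x"] additive_tagged_division_1[where f= f]
              \<open>a \<le> b\<close> ptag by auto
      define q where "q = {(x, K) \<in> p. x \<in> N}"
      have qtag: "q tagged_partial_division_of {a..b}"
        using ptag by (auto simp: q_def tagged_division_of_def intro: tagged_partial_division_subset)
      have qs: "(\<Sum>(x, K)\<in>q. \<bar>f (Sup K) - f (Inf K)\<bar>) < e / 2"
      proof (rule U(3)[OF qtag])
        fix x K assume "(x, K) \<in> q"
        then have "(x, K) \<in> p" "x \<in> N" by (auto simp: q_def)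
        then show "K \<subseteq> U" using fineD[OF fine, of x K] by (simp add: \<gamma>_def)
      qed
      have bnd: "\<bar>measure lborel K *\<^sub>R g x - (f (Sup K) - f (Inf K))\<bar>
          \<le> (if x \<in> N then \<bar>f (Sup K) - f (Inf K)\<bar> else 0) + e' * (Sup K - Inf K)" if xK: "(x, K) \<in> p" for x K
      proof -
        obtain u v where k: "K = {u..v}" using pD(4)[OF xK] by auto
        have "x \<in> K" and kab: "K \<subseteq> {a..b}" using pD(2,3)[OF xK] by auto
        then have "u \<le> v" and uv: "u \<in> K" "v \<in> K" by (auto simp: k)
        show ?thesis
        proof (cases "x \<in> N")
          case True
          moreover have "0 \<le> e' * (v - u)" using \<open>u \<le> v\<close> \<open>e' > 0\<close> by simp
          ultimately show ?thesis using \<open>u \<le> v\<close> by (simp add: g_def k abs_minus_commute)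
        next
          case False
          have ball: "y \<in> ball x (d x)" if "y \<in> K" for y
            using fineD[OF fine \<open>(x, K) \<in> p\<close>] False that by (auto simp: \<gamma>_def)
          have xab: "x \<in> {a..b} - N" using False \<open>x \<in> K\<close> kab by auto
          have 1: "norm (f u - f x - (u - x) *\<^sub>R f' x) \<le> e' * norm (u - x)"
            using ball[OF uv(1)] kab uv xab by (intro d) (auto simp: dist_real_def)
          have 2: "norm (f v - f x - (v - x) *\<^sub>R f' x) \<le> e' * norm (v - x)"
            using ball[OF uv(2)] kab uv xab by (intro d) (auto simp: dist_real_def)
          have "\<bar>(v - u) * f' x - (f v - f u)\<bar> \<le> e' * norm (u - x) + e' * norm (v - x)"
            using 1 2 by (simp add: algebra_simps abs_if split: if_splits)
          also have "\<dots> = e' * (v - u)"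
            using \<open>x \<in> K\<close> by (simp add: k algebra_simps)
          finally show ?thesis using False \<open>u \<le> v\<close> by (simp add: g_def k)
        qed
      qed
      have "norm ((\<Sum>(x,k)\<in>p. measure lborel k *\<^sub>R g x) - (f b - f a))
          = norm (\<Sum>(x,K)\<in>p. measure lborel K *\<^sub>R g x - (f(Sup K) - f(Inf K)))"
        by (simp add: ba(2) sum_subtractf case_prod_beta)
      also have "\<dots> \<le> (\<Sum>(x,K)\<in>p. (if x \<in> N then \<bar>f (Sup K) - f (Inf K)\<bar> else 0) + e' * (Sup K - Inf K))"
        by (rule sum_norm_le) (use bnd in auto)
      also have "\<dots> = (\<Sum>(x,K)\<in>p. (if x \<in> N then \<bar>f (Sup K) - f (Inf K)\<bar> else 0)) + e' * (b - a)"
        by (simp add: ba(1) sum.distrib sum_distrib_left case_prod_beta)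
      also have "(\<Sum>(x,K)\<in>p. (if x \<in> N then \<bar>f (Sup K) - f (Inf K)\<bar> else 0))
          = (\<Sum>(x, K)\<in>q. \<bar>f (Sup K) - f (Inf K)\<bar>)"
        unfolding q_def using pD(1)
        by (intro sum.mono_neutral_cong_right) (auto split: if_splits)
      finally show "norm ((\<Sum>(x,k)\<in>p. measure lborel k *\<^sub>R g x) - (f b - f a)) < e"
        using qs e'2 by simp
    qed
  qed
  then show ?thesis
    by (rule has_integral_spike[OF N, rotated]) (auto simp: g_def)
qed

section \<open>Lebesgue--Stieltjes measures\<close>

lemma borel_measurable_right_continuous:
  fixes f :: "real \<Rightarrow> real"
  assumes "\<And>t. continuous (at_right t) f"
  shows "f \<in> borel_measurable borel"
proof (rule borel_measurable_LIMSEQ_real)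
  \<comment> \<open>\<open>r n s\<close> is the first point strictly above s of the grid with mesh
    1/(n+1). It tends to s from the right and takes countably many values, so
    \<open>f (r n s)\<close> is measurable whatever f is.\<close>
  define r where "r n s = (of_int \<lfloor>real (Suc n) * s\<rfloor> + 1) / real (Suc n)" for n s
  show "(\<lambda>n. f (r n s)) \<longlonglongrightarrow> f s" for s
  proof (rule filterlim_compose[of f])
    show "(f \<longlongrightarrow> f s) (at_right s)" using assms[of s] by (simp add: continuous_within)
    have r: "s < r n s \<and> r n s \<le> s + inverse (real (Suc n))" for n
    proof -
      have "real (Suc n) * s < of_int \<lfloor>real (Suc n) * s\<rfloor> + 1"
           "of_int \<lfloor>real (Suc n) * s\<rfloor> + 1 \<le> real (Suc n) * s + 1" by linarith+
      then show ?thesis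
        by (simp add: r_def pos_less_divide_eq pos_divide_le_eq distrib_left mult.commute[of _ "real (Suc n)"] del: of_nat_Suc)
    qed
    show "filterlim (\<lambda>n. r n s) (at_right s) sequentially"
      unfolding filterlim_at
    proof
      show "(\<lambda>n. r n s) \<longlonglongrightarrow> s"
      proof (rule tendsto_sandwich[of "\<lambda>n. s" _ _ "\<lambda>n. s + inverse (real (Suc n))"])
        show "(\<lambda>n. s + inverse (real (Suc n))) \<longlonglongrightarrow> s"
          using LIMSEQ_inverse_real_of_nat_add[of s] by simp
      qed (use r in \<open>auto intro!: always_eventually less_imp_le simp del: of_nat_Suc\<close>)
    qed (use r in \<open>auto intro!: always_eventually simp: less_imp_neq[symmetric]\<close>)
  qed
  show "(\<lambda>s. f (r n s)) \<in> borel_measurable borel" for n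
    unfolding r_def
    by (rule measurable_compose[of "\<lambda>s. \<lfloor>real (Suc n) * s\<rfloor>" borel "count_space UNIV"
          "\<lambda>k. f ((of_int k + 1) / real (Suc n))"]) measurable
qed

lemma continuous_at_right_max0:
  fixes f :: "real \<Rightarrow> real"
  assumes "\<forall>t\<ge>0. continuous (at_right t) f"
  shows "continuous (at_right t) (\<lambda>s. f (max 0 s))"
proof (cases "t \<ge> 0")
  case True
  have "(f \<longlongrightarrow> f t) (at_right t)" using assms True by (simp add: continuous_within)
  moreover have "eventually (\<lambda>s. f s = f (max 0 s)) (at_right t)"
    using eventually_at_right_less[of t] by eventually_elim (use True in auto)
  ultimately have "((\<lambda>s. f (max 0 s)) \<longlongrightarrow> f t) (at_right t)"
    by (rule Lim_transform_eventually)
  then show ?thesis using True by (simp add: continuous_within)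
next
  case False
  then have "eventually (\<lambda>s. f 0 = f (max 0 s)) (at_right t)"
    by (auto simp: eventually_at_right[of t 0] intro!: exI[of _ 0])
  then have "((\<lambda>s. f (max 0 s)) \<longlongrightarrow> f 0) (at_right t)"
    by (rule Lim_transform_eventually[OF tendsto_const])
  then show ?thesis using False by (simp add: continuous_within)
qed

section \<open>Atoms, flat pieces and upper bounds of a monotone right-continuous function\<close>

context
  fixes F :: "real \<Rightarrow> real"
  assumes mono_F: "mono F" and rcont_F: "\<And>t. continuous (at_right t) F"
begin

lemma emeasure_interval_measure_singleton:
  assumes L: "(F \<longlongrightarrow> L) (at_left a)"
  shows "emeasure (interval_measure F) {a} = ennreal (F a - L)"
proof (rule LIMSEQ_unique)
  let ?X = "\<lambda>n. a - inverse (real (Suc n))"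
  have X: "?X \<longlonglongrightarrow> a"
    using LIMSEQ_inverse_real_of_nat_add_minus[of a] by (simp only: diff_conv_add_uminus)
  have e: "emeasure (interval_measure F) {?X n<..a} = ennreal (F a - F (?X n))" for n
    using mono_F rcont_F by (intro emeasure_interval_measure_Ioc) (auto simp: mono_def)
  have "(\<lambda>n. emeasure (interval_measure F) {?X n<..a}) \<longlonglongrightarrow> emeasure (interval_measure F) (\<Inter>n. {?X n<..a})"
  proof (rule Lim_emeasure_decseq)
    have le: "inverse (real (Suc n)) \<le> inverse (real (Suc m))" if "m \<le> n" for m n
      using that by (intro le_imp_inverse_le) auto
    show "decseq (\<lambda>n. {?X n<..a})"
      unfolding decseq_def
    proof (intro allI impI subsetI)
      fix m n x assume "m \<le> n" "x \<in> {?X n<..a}"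
      with le[of m n] show "x \<in> {?X m<..a}" unfolding greaterThanAtMost_iff by linarith
    qed
  qed (use e in auto)
  also have "(\<Inter>n. {?X n<..a}) = {a}"
  proof (intro equalityI subsetI)
    fix x assume x: "x \<in> (\<Inter>n. {?X n<..a})"
    then have "x \<le> a" by auto
    moreover have "a \<le> x"
    proof (rule LIMSEQ_le_const2[OF X])
      show "\<exists>N. \<forall>n\<ge>N. a - inverse (real (Suc n)) \<le> x"
        using x by (auto intro: less_imp_le simp del: of_nat_Suc)
    qed
    ultimately show "x \<in> {a}" by simp
  qed auto
  finally show "(\<lambda>n. ennreal (F a - F (?X n))) \<longlonglongrightarrow> emeasure (interval_measure F) {a}"
    by (simp only: e)
  have "filterlim ?X (at_left a) sequentially"
    unfolding filterlim_at
  proof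
    show "?X \<longlonglongrightarrow> a" by (rule X)
  qed simp
  then have "(\<lambda>n. F (?X n)) \<longlonglongrightarrow> L" by (rule filterlim_compose[OF L])
  then show "(\<lambda>n. ennreal (F a - F (?X n))) \<longlonglongrightarrow> ennreal (F a - L)"
    by (intro tendsto_ennrealI tendsto_diff tendsto_const)
qed

text \<open>The measure is carried by left jumps and points of increase to the right. To see this,
  group the exceptional points by a rational q on the same level. With a their infimum, right
  continuity gives \<open>F a = F q\<close>, so (a, q] is null; the point a is itself exceptional
  only if F is left-continuous there, and then it is no atom. Countably many groups suffice.\<close>

lemma AE_interval_measure_not_flat:
  "AE s in interval_measure F. \<not> (continuous (at_left s) F \<and> (\<exists>t>s. F t = F s))"
proof -
  \<comment> \<open>The rational q witnesses the flat piece to the right of s; p serves only to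
    bound the set below, so that its infimum exists.\<close>
  define A where "A p q = {s. p < s \<and> s < q \<and> F s = F q \<and> continuous (at_left s) F}" for p q
  have null: "\<exists>N\<in>null_sets (interval_measure F). A p q \<subseteq> N" for p q
  proof (cases "A p q = {}")
    case False
    define a where "a = Inf (A p q)"
    have bdd: "bdd_below (A p q)" by (auto simp: A_def bdd_below_def intro!: exI[of _ p] less_imp_le)
    have a_le: "a \<le> s" if "s \<in> A p q" for s
      using cInf_lower[OF that bdd] by (simp add: a_def)
    have aq: "a < q" using a_le False by (force simp: A_def)
    have "F a \<ge> F q"
    proof (rule ccontr)
      assume "\<not> F q \<le> F a"
      then have "eventually (\<lambda>x. F x < F q) (at_right a)"
        using rcont_F[of a] by (intro order_tendstoD) (auto simp: continuous_within)
      then obtain b where b: "b > a" "\<And>x. a < x \<Longrightarrow> x < b \<Longrightarrow> F x < F q"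
        by (auto simp: eventually_at_right[OF aq])
      obtain s where s: "s \<in> A p q" "s < b"
        using cInf_lessD[OF False, of b] b(1) by (auto simp: a_def)
      then have "a = s" using a_le[OF s(1)] b(2)[of s] by (cases "a < s") (auto simp: A_def)
      with s \<open>\<not> F q \<le> F a\<close> show False by (simp add: A_def)
    qed
    with mono_F aq have Fa: "F a = F q" by (auto simp: mono_def intro: antisym)
    have n1: "{a<..q} \<in> null_sets (interval_measure F)"
      using mono_F rcont_F aq Fa
      by (auto simp: null_sets_def mono_def emeasure_interval_measure_Ioc)
    show ?thesis
    proof (cases "a \<in> A p q")
      case True
      then have "continuous (at_left a) F" unfolding A_def by blast
      then have "(F \<longlongrightarrow> F a) (at_left a)" by (simp add: continuous_within)
      from emeasure_interval_measure_singleton[OF this]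
      have "{a} \<in> null_sets (interval_measure F)" by (auto simp: null_sets_def)
      with n1 have "{a} \<union> {a<..q} \<in> null_sets (interval_measure F)" by blast
      moreover have "A p q \<subseteq> {a} \<union> {a<..q}" using a_le by (fastforce simp: A_def)
      ultimately show ?thesis by blast
    next
      case False
      then have "A p q \<subseteq> {a<..q}" using a_le by (force simp: A_def order.order_iff_strict)
      with n1 show ?thesis by blast
    qed
  qed auto
  have "AE s in interval_measure F. \<forall>p\<in>\<rat>. \<forall>q\<in>\<rat>. s \<notin> A p q"
  proof (intro AE_ball_countable[THEN iffD2] countable_rat ballI)
    fix p q :: real
    obtain N where "N \<in> null_sets (interval_measure F)" "A p q \<subseteq> N" using null by blast
    then show "AE s in interval_measure F. s \<notin> A p q"
      by (auto intro: AE_I')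
  qed
  then show ?thesis
  proof eventually_elim
    fix s assume s: "\<forall>p\<in>\<rat>. \<forall>q\<in>\<rat>. s \<notin> A p q"
    show "\<not> (continuous (at_left s) F \<and> (\<exists>t>s. F t = F s))"
    proof
      assume "continuous (at_left s) F \<and> (\<exists>t>s. F t = F s)"
      then obtain t where t: "continuous (at_left s) F" "t > s" "F t = F s" by blast
      obtain q where q: "q \<in> \<rat>" "s < q" "q < t" using Rats_dense_in_real[OF t(2)] by blast
      obtain p where p: "p \<in> \<rat>" "p < s" using Rats_dense_in_real[of "s - 1" s] by auto
      have "F s \<le> F q" "F q \<le> F t" using q mono_F by (auto simp: mono_def)
      with t have "s \<in> A p q" using p q by (auto simp: A_def)
      with s p q show False by blast
    qed
  qed
qed

text \<open>An increasing function can cross the level R only by putting mass on points above R. The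
  set B of such points in (a, t] is an interval ending at t. If it contains its left end b, then b
  is an atom, since \<open>F b > R\<close> while the left limit is at most R; otherwise (b, t] has
  mass \<open>F t - F b > 0\<close>. This later gives the minimality of K from the fact that dK
  charges only the times with V = 0.\<close>

lemma AE_interval_measure_le_imp_le:
  assumes "a \<le> t" "F a \<le> R" and ae: "AE s in interval_measure F. s \<in> {a<..t} \<longrightarrow> F s \<le> R"
  shows "F t \<le> R"
proof (rule ccontr)
  assume "\<not> F t \<le> R"
  define B where "B = {s \<in> {a<..t}. F s > R}"
  have B: "B \<in> null_sets (interval_measure F)"
  proof -
    have "F \<in> borel_measurable borel" using mono_F by (rule borel_measurable_mono)
    then have "B \<in> sets borel" unfolding B_def by measurable
    then show ?thesis using ae by (intro AE_iff_null_sets[THEN iffD2]) (auto simp: B_def elim: eventually_mono)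
  qed
  have tB: "t \<in> B" using assms \<open>\<not> F t \<le> R\<close> by (cases "a = t") (auto simp: B_def)
  define b where "b = Inf B"
  have bdd: "bdd_below B" by (auto simp: B_def bdd_below_def intro!: exI[of _ a] less_imp_le)
  have b_le: "b \<le> s" if "s \<in> B" for s using cInf_lower[OF that bdd] by (simp add: b_def)
  have ab: "a \<le> b" using tB unfolding b_def by (intro cInf_greatest) (auto simp: B_def)
  have bt: "b \<le> t" using b_le[OF tB] .
  have gtB: "s \<in> B" if "b < s" "s \<le> t" for s
  proof -
    obtain s' where s': "s' \<in> B" "s' < s" using cInf_lessD[of B s] \<open>b < s\<close> tB unfolding b_def by blast
    then have "F s' \<le> F s" using mono_F by (auto simp: mono_def)
    with s' that ab show ?thesis by (auto simp: B_def)
  qed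
  show False
  proof (cases "b \<in> B")
    case True
    have "(F \<longlongrightarrow> Sup (F ` ({..<b} \<inter> UNIV))) (at b within ({..<b} \<inter> UNIV))"
      by (rule Lim_left_bound[where K = "F b"]) (use mono_F in \<open>auto simp: mono_def\<close>)
    then obtain L where L: "(F \<longlongrightarrow> L) (at_left b)" by auto
    have "ennreal (F b - L) = emeasure (interval_measure F) {b}"
      by (rule emeasure_interval_measure_singleton[OF L, symmetric])
    also have "\<dots> = 0"
      using null_sets_subset[OF B, of "{b}"] True by (auto dest: null_setsD1)
    finally have "F b \<le> L" by (simp add: ennreal_eq_0_iff)
    moreover have "L \<le> R"
    proof (rule tendsto_upperbound[OF L])
      have "a < b" using True by (simp add: B_def)
      then show "eventually (\<lambda>s. F s \<le> R) (at_left b)"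
        unfolding eventually_at_left[OF \<open>a < b\<close>]
        using b_le bt by (intro exI[of _ a]) (force simp: B_def)
    qed auto
    ultimately show False using True by (simp add: B_def)
  next
    case False
    then have "b < t" "F b \<le> R" using tB ab bt assms by (auto simp: B_def order.order_iff_strict)
    have "ennreal (F t - F b) = emeasure (interval_measure F) {b<..t}"
      using mono_F rcont_F bt by (subst emeasure_interval_measure_Ioc) (auto simp: mono_def)
    also have "\<dots> = 0"
    proof -
      have "{b<..t} \<subseteq> B" using gtB by auto
      with null_sets_subset[OF B _ this] show ?thesis by (auto dest: null_setsD1)
    qed
    finally have "F t \<le> F b" by (simp add: ennreal_eq_0_iff)
    with \<open>F b \<le> R\<close> \<open>\<not> F t \<le> R\<close> show False by simp
  qed
qed

end

text \<open>The image under F of its own Stieltjes measure on (a, b] is Lebesgue measure on (F a, F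
  b], and it is enough to compare both on rays. Continuity is essential: a jump of F would skip
  levels that Lebesgue measure charges.\<close>

lemma nn_integral_interval_measure_change_time:
  fixes F :: "real \<Rightarrow> real" and \<phi> :: "real \<Rightarrow> ennreal"
  assumes mono_F: "mono F" and cont_F: "continuous_on UNIV F" and "a \<le> b"
    and [measurable]: "\<phi> \<in> borel_measurable borel"
  shows "(\<integral>\<^sup>+s\<in>{a<..b}. \<phi> (F s) \<partial>interval_measure F) = (\<integral>\<^sup>+x\<in>{F a<..F b}. \<phi> x \<partial>lborel)"
proof -
  let ?D = "interval_measure F"
  have rc: "continuous (at_right t) F" for t
    using cont_F by (simp add: continuous_on_eq_continuous_within continuous_at_imp_continuous_at_within)
  have Ioc: "emeasure ?D {c<..d} = ennreal (F d - F c)" if "c \<le> d" for c d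
    using mono_F rc that by (intro emeasure_interval_measure_Ioc) (auto simp: mono_def)
  have [measurable]: "F \<in> borel_measurable borel" using mono_F by (rule borel_measurable_mono)
  define M where "M = distr (density ?D (indicator {a<..b})) borel F"
  define N where "N = density lborel (indicator {F a<..F b} :: real \<Rightarrow> ennreal)"
  have eM: "emeasure M A = emeasure ?D ({a<..b} \<inter> F -` A)" if [measurable]: "A \<in> sets borel" for A
  proof -
    have "emeasure M A = emeasure (density ?D (indicator {a<..b})) (F -` A)"
      unfolding M_def using measurable_sets[of F borel borel A] by (subst emeasure_distr) auto
    also have "\<dots> = emeasure ?D ({a<..b} \<inter> F -` A)"
      using measurable_sets[of F borel borel A]
      by (subst emeasure_density) (auto simp: indicator_inter_arith[symmetric])
    finally show ?thesis .
  qed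
  have eN: "emeasure N A = emeasure lborel ({F a<..F b} \<inter> A)" if "A \<in> sets borel" for A
    using that unfolding N_def
    by (subst emeasure_density) (auto simp: indicator_inter_arith[symmetric])
  have Fab: "F a \<le> F b" using mono_F \<open>a \<le> b\<close> by (auto simp: mono_def)
  have key: "emeasure ?D ({a<..b} \<inter> F -` {x<..}) = emeasure lborel ({F a<..F b} \<inter> {x<..})" for x
  proof -
    consider "x < F a" | "F b \<le> x" | "F a \<le> x" "x < F b" by linarith
    then show ?thesis
    proof cases
      case 1
      have "F a \<le> F s" if "a < s" for s using mono_F that by (auto simp: mono_def)
      then have "{a<..b} \<inter> F -` {x<..} = {a<..b}" using 1 by force
      moreover have "{F a<..F b} \<inter> {x<..} = {F a<..F b}" using 1 by auto
      ultimately show ?thesis using Ioc[OF \<open>a \<le> b\<close>] Fab by simp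
    next
      case 2
      have "F s \<le> F b" if "s \<le> b" for s using mono_F that by (auto simp: mono_def)
      then have "{a<..b} \<inter> F -` {x<..} = {}" using 2 by force
      moreover have "{F a<..F b} \<inter> {x<..} = {}" using 2 by auto
      ultimately show ?thesis by simp
    next
      case 3
      \<comment> \<open>The maximum c of C is the last time at which F is at most x. There
        \<open>F c = x\<close> by the intermediate value theorem, so the part of (a, b] above level
        x is (c, b].\<close>
      define C where "C = {a..b} \<inter> F -` {..x}"
      have "compact C" unfolding C_def
        using cont_F by (intro compact_Int_closed compact_Icc closed_vimage) (auto intro: continuous_on_subset)
      moreover have "a \<in> C" using 3 \<open>a \<le> b\<close> by (simp add: C_def)
      ultimately obtain c where c: "c \<in> C" "\<And>s. s \<in> C \<Longrightarrow> s \<le> c"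
        using compact_attains_sup[of C] by blast
      have cab: "a \<le> c" "c \<le> b" "F c \<le> x" using c(1) by (auto simp: C_def)
      have "F c = x"
      proof (rule ccontr)
        assume "F c \<noteq> x"
        obtain d where d: "c \<le> d" "d \<le> b" "F d = x"
          using IVT'[of F c x b] cab 3 continuous_on_subset[OF cont_F] by auto
        then have "d \<in> C" using cab by (auto simp: C_def)
        then show False using c(2) d \<open>F c \<noteq> x\<close> by force
      qed
      have "{a<..b} \<inter> F -` {x<..} = {c<..b}"
      proof (intro equalityI subsetI)
        fix s assume s: "s \<in> {a<..b} \<inter> F -` {x<..}"
        then have "c < s" using mono_F \<open>F c = x\<close> by (force simp: mono_def not_le[symmetric])
        then show "s \<in> {c<..b}" using s by simp
      next
        fix s assume s: "s \<in> {c<..b}"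
        then have "s \<notin> C" using c(2)[of s] by auto
        then show "s \<in> {a<..b} \<inter> F -` {x<..}" using s cab by (auto simp: C_def)
      qed
      moreover have "{F a<..F b} \<inter> {x<..} = {x<..F b}" using 3 by auto
      ultimately show ?thesis using Ioc[OF cab(2)] 3 \<open>F c = x\<close> by simp
    qed
  qed
  have MN: "M = N"
  proof (rule measure_eqI_lessThan)
    show "emeasure M {x<..} < \<infinity>" for x
    proof -
      have "emeasure M {x<..} \<le> emeasure ?D {a<..b}"
        using eM[of "{x<..}"] by (auto intro!: emeasure_mono)
      then show ?thesis using Ioc[OF \<open>a \<le> b\<close>] by (simp add: order_le_less_trans)
    qed
    show "emeasure M {x<..} = emeasure N {x<..}" for x
      using key eM eN by simp
  qed (auto simp: M_def N_def)
  have "(\<integral>\<^sup>+s\<in>{a<..b}. \<phi> (F s) \<partial>?D) = (\<integral>\<^sup>+x. \<phi> x \<partial>M)"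
    unfolding M_def
    by (subst nn_integral_distr) (auto simp: nn_integral_density mult.commute)
  also have "\<dots> = (\<integral>\<^sup>+x\<in>{F a<..F b}. \<phi> x \<partial>lborel)"
    unfolding MN N_def by (auto simp: nn_integral_density mult.commute)
  finally show ?thesis .
qed

text \<open>The hypothesis says that dG = \<open>\<psi>\<close> dF on the intervals (c, b]. These
  are exactly the traces of rays on (a, b], so the two measures coincide there and integrate every
  \<open>\<phi>\<close> alike.\<close>

lemma nn_integral_interval_measure_density:
  fixes F G :: "real \<Rightarrow> real" and \<phi> \<psi> :: "real \<Rightarrow> ennreal"
  assumes G: "mono G" "\<And>t. continuous (at_right t) G"
    and [measurable]: "\<phi> \<in> borel_measurable borel" "\<psi> \<in> borel_measurable borel"
    and FG: "\<And>c. a \<le> c \<Longrightarrow> c \<le> b \<Longrightarrow> ennreal (G b - G c) = (\<integral>\<^sup>+s\<in>{c<..b}. \<psi> s \<partial>interval_measure F)"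
    and "a \<le> b"
  shows "(\<integral>\<^sup>+s\<in>{a<..b}. \<phi> s \<partial>interval_measure G) = (\<integral>\<^sup>+s\<in>{a<..b}. \<phi> s * \<psi> s \<partial>interval_measure F)"
proof -
  define M where "M = density (interval_measure G) (indicator {a<..b})"
  define N where "N = density (interval_measure F) (\<lambda>s. \<psi> s * indicator {a<..b} s)"
  have Ioc: "emeasure (interval_measure G) {c<..d} = ennreal (G d - G c)" if "c \<le> d" for c d
    using G that by (intro emeasure_interval_measure_Ioc) (auto simp: mono_def)
  have eM: "emeasure M A = emeasure (interval_measure G) ({a<..b} \<inter> A)" if "A \<in> sets borel" for A
    using that unfolding M_def
    by (subst emeasure_density) (auto simp: indicator_inter_arith[symmetric])
  have eN: "emeasure N A = (\<integral>\<^sup>+s\<in>({a<..b} \<inter> A). \<psi> s \<partial>interval_measure F)" if "A \<in> sets borel" for A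
    using that unfolding N_def
    by (subst emeasure_density) (auto simp: indicator_inter_arith mult.assoc)
  have MN: "M = N"
  proof (rule measure_eqI_lessThan)
    show "emeasure M {x<..} < \<infinity>" for x
    proof -
      have "emeasure M {x<..} \<le> emeasure (interval_measure G) {a<..b}"
        using eM[of "{x<..}"] by (auto intro!: emeasure_mono)
      then show ?thesis using Ioc[OF \<open>a \<le> b\<close>] by (simp add: order_le_less_trans)
    qed
    show "emeasure M {x<..} = emeasure N {x<..}" for x
    proof (cases "x \<le> b")
      case True
      have "{a<..b} \<inter> {x<..} = {max a x<..b}" by auto
      then show ?thesis using eM[of "{x<..}"] eN[of "{x<..}"] FG[of "max a x"] Ioc[of "max a x" b] True \<open>a \<le> b\<close>
        by simp
    next
      case False
      then have "{a<..b} \<inter> {x<..} = {}" by auto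
      then show ?thesis using eM[of "{x<..}"] eN[of "{x<..}"] by simp
    qed
  qed (auto simp: M_def N_def)
  have "(\<integral>\<^sup>+s\<in>{a<..b}. \<phi> s \<partial>interval_measure G) = (\<integral>\<^sup>+s. \<phi> s \<partial>M)"
    unfolding M_def by (subst nn_integral_density) (auto simp: mult.commute)
  also have "\<dots> = (\<integral>\<^sup>+s\<in>{a<..b}. \<phi> s * \<psi> s \<partial>interval_measure F)"
    unfolding MN N_def by (subst nn_integral_density) (auto simp: ac_simps)
  finally show ?thesis .
qed

text \<open>From dG = p(G) dF follows dF = dG / p(G), and the continuous G transports dG to Lebesgue
  measure. It is used with F the identity for the ODE and with F = S for a tax-reflection pair;
  comparing the two outcomes identifies U with h(S).\<close>

lemma separation_of_variables:
  fixes F G p :: "real \<Rightarrow> real"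
  assumes F: "mono F" "\<And>t. continuous (at_right t) F" and G: "mono G" "continuous_on UNIV G"
    and [measurable]: "p \<in> borel_measurable borel" and p: "\<And>x. p x > 0"
    and FG: "\<And>c. a \<le> c \<Longrightarrow> c \<le> b \<Longrightarrow>
      ennreal (G b - G c) = (\<integral>\<^sup>+s\<in>{c<..b}. ennreal (p (G s)) \<partial>interval_measure F)"
    and "a \<le> b"
  shows "ennreal (F b - F a) = (\<integral>\<^sup>+x\<in>{G a<..G b}. ennreal (inverse (p x)) \<partial>lborel)"
proof -
  have [measurable]: "G \<in> borel_measurable borel" using G(1) by (rule borel_measurable_mono)
  have rc: "continuous (at_right t) G" for t
    using G(2) by (simp add: continuous_on_eq_continuous_within continuous_at_imp_continuous_at_within)
  have "(\<integral>\<^sup>+x\<in>{G a<..G b}. ennreal (inverse (p x)) \<partial>lborel)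
      = (\<integral>\<^sup>+s\<in>{a<..b}. ennreal (inverse (p (G s))) \<partial>interval_measure G)"
    by (rule nn_integral_interval_measure_change_time[OF G \<open>a \<le> b\<close>, symmetric]) measurable
  also have "\<dots> = (\<integral>\<^sup>+s\<in>{a<..b}. ennreal (inverse (p (G s))) * ennreal (p (G s)) \<partial>interval_measure F)"
    by (rule nn_integral_interval_measure_density[OF G(1) rc _ _ FG \<open>a \<le> b\<close>]) measurable
  also have "\<dots> = (\<integral>\<^sup>+s. indicator {a<..b} s \<partial>interval_measure F)"
  proof (rule nn_integral_cong)
    fix s
    have "ennreal (inverse (p (G s))) * ennreal (p (G s)) = 1"
      using p[of "G s"] by (simp add: ennreal_mult'[symmetric] less_imp_le)
    then show "ennreal (inverse (p (G s))) * ennreal (p (G s)) * indicator {a<..b} s = indicator {a<..b} s"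
      by simp
  qed
  also have "\<dots> = ennreal (F b - F a)"
    using F \<open>a \<le> b\<close> by (simp add: emeasure_interval_measure_Ioc mono_def)
  finally show ?thesis by simp
qed

lemma set_nn_integral_pos_eq_0_imp_null:
  fixes f :: "'a \<Rightarrow> ennreal"
  assumes "(\<integral>\<^sup>+x\<in>A. f x \<partial>M) = 0" "A \<in> sets M" "f \<in> borel_measurable M" "\<And>x. 0 < f x"
  shows "emeasure M A = 0"
proof -
  have "AE x in M. f x * indicator A x = 0"
    using assms by (subst nn_integral_0_iff_AE[symmetric]) auto
  then have "AE x in M. x \<notin> A"
  proof eventually_elim
    case (elim x)
    then show ?case using assms(4)[of x] by (auto simp: indicator_def)
  qed
  then show ?thesis
    using assms(2) by (auto simp: AE_iff_null_sets[symmetric] dest: null_setsD1)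
qed

text \<open>Equal finite integrals leave a zero integral over the interval between the two upper
  limits; as f is positive, that interval has length 0. It serves to invert the formula produced by
  separation of variables.\<close>

lemma set_nn_integral_Ioc_inject:
  fixes f :: "real \<Rightarrow> ennreal"
  assumes eq: "(\<integral>\<^sup>+x\<in>{a<..u}. f x \<partial>lborel) = (\<integral>\<^sup>+x\<in>{a<..v}. f x \<partial>lborel)"
    and fin: "(\<integral>\<^sup>+x\<in>{a<..u}. f x \<partial>lborel) < \<infinity>"
    and [measurable]: "f \<in> borel_measurable borel" and pos: "\<And>x. 0 < f x" and "a \<le> u" "a \<le> v"
  shows "u = v"
proof -
  have le: "v' \<le> u'" if "a \<le> u'" "u' \<le> v'" and fin: "(\<integral>\<^sup>+x\<in>{a<..u'}. f x \<partial>lborel) < \<infinity>"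
    and eq: "(\<integral>\<^sup>+x\<in>{a<..u'}. f x \<partial>lborel) = (\<integral>\<^sup>+x\<in>{a<..v'}. f x \<partial>lborel)" for u' v'
  proof -
    have "(\<integral>\<^sup>+x\<in>{a<..v'}. f x \<partial>lborel)
        = (\<integral>\<^sup>+x. f x * indicator {a<..u'} x + f x * indicator {u'<..v'} x \<partial>lborel)"
      using that by (intro nn_integral_cong) (auto simp: indicator_def)
    also have "\<dots> = (\<integral>\<^sup>+x\<in>{a<..u'}. f x \<partial>lborel) + (\<integral>\<^sup>+x\<in>{u'<..v'}. f x \<partial>lborel)"
      by (rule nn_integral_add) auto
    finally have "(\<integral>\<^sup>+x\<in>{u'<..v'}. f x \<partial>lborel) = 0"
      using eq fin by (metis add_0_right ennreal_add_left_cancel infinity_ennreal_def less_irrefl)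
    then have "emeasure lborel {u'<..v'} = 0"
      by (rule set_nn_integral_pos_eq_0_imp_null) (use pos in auto)
    then show ?thesis using that(2) by (simp add: ennreal_eq_0_iff)
  qed
  show ?thesis
  proof (cases "u \<le> v")
    case True
    have "v \<le> u" by (rule le[OF \<open>a \<le> u\<close> True fin eq])
    with True show ?thesis by simp
  next
    case False
    then have "v \<le> u" by simp
    have "u \<le> v" by (rule le[OF \<open>a \<le> v\<close> \<open>v \<le> u\<close> fin[unfolded eq] eq[symmetric]])
    with \<open>v \<le> u\<close> show ?thesis by simp
  qed
qed

text \<open>With \<open>\<psi>\<close> as tax rate this splits the growth of F into tax and net
  income. The last claim trades the signed integral in the definition of the tax for a nonnegative
  integral of \<open>1 - \<psi>\<close>, the form used by change of time and separation of
  variables.\<close>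

lemma set_integral_interval_measure_complement:
  fixes F \<psi> :: "real \<Rightarrow> real"
  assumes F: "mono F" "\<And>t. continuous (at_right t) F"
    and [measurable]: "\<psi> \<in> borel_measurable borel" and \<psi>: "\<And>x. 0 \<le> \<psi> x \<and> \<psi> x \<le> 1" and "a \<le> b"
  shows "set_integrable (interval_measure F) {a<..b} \<psi>"
    and "0 \<le> (LINT s:{a<..b}|interval_measure F. \<psi> s)"
    and "(LINT s:{a<..b}|interval_measure F. \<psi> s) \<le> F b - F a"
    and "ennreal (F b - F a - (LINT s:{a<..b}|interval_measure F. \<psi> s))
       = (\<integral>\<^sup>+s\<in>{a<..b}. ennreal (1 - \<psi> s) \<partial>interval_measure F)"
proof -
  let ?D = "interval_measure F"
  have e: "emeasure ?D {a<..b} = ennreal (F b - F a)" and m: "measure ?D {a<..b} = F b - F a"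
    using F \<open>a \<le> b\<close>
    by (auto simp: emeasure_interval_measure_Ioc measure_interval_measure_Ioc mono_def)
  have int1: "set_integrable ?D {a<..b} (\<lambda>s. 1 :: real)"
    using e by (simp add: set_integrable_def)
  then show int: "set_integrable ?D {a<..b} \<psi>"
    unfolding set_integrable_def
    by (rule Bochner_Integration.integrable_bound) (use \<psi> in \<open>auto simp: indicator_def\<close>)
  show "0 \<le> (LINT s:{a<..b}|?D. \<psi> s)"
    unfolding set_lebesgue_integral_def using \<psi> by (intro integral_nonneg_AE) (auto simp: indicator_def)
  have one: "(LINT s:{a<..b}|?D. (1 :: real)) = F b - F a"
    by (simp add: set_lebesgue_integral_def m)
  then have diff: "(LINT s:{a<..b}|?D. 1 - \<psi> s) = F b - F a - (LINT s:{a<..b}|?D. \<psi> s)"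
    using set_integral_diff(2)[OF int1 int] by simp
  have "0 \<le> (LINT s:{a<..b}|?D. 1 - \<psi> s)"
    unfolding set_lebesgue_integral_def using \<psi> by (intro integral_nonneg_AE) (auto simp: indicator_def)
  with diff show "(LINT s:{a<..b}|?D. \<psi> s) \<le> F b - F a" by simp
  have "(\<integral>\<^sup>+s\<in>{a<..b}. ennreal (1 - \<psi> s) \<partial>?D) = (\<integral>\<^sup>+s. ennreal (indicator {a<..b} s *\<^sub>R (1 - \<psi> s)) \<partial>?D)"
    by (intro nn_integral_cong) (auto simp: indicator_def)
  also have "\<dots> = ennreal (LINT s:{a<..b}|?D. 1 - \<psi> s)"
    unfolding set_lebesgue_integral_def
    using set_integral_diff(1)[OF int1 int] \<psi>
    by (intro nn_integral_eq_integral) (auto simp: set_integrable_def indicator_def)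
  finally show "ennreal (F b - F a - (LINT s:{a<..b}|?D. \<psi> s)) = (\<integral>\<^sup>+s\<in>{a<..b}. ennreal (1 - \<psi> s) \<partial>?D)"
    by (simp add: diff)
qed

section \<open>The pair of running suprema\<close>

lemma mono_on_at_right_limit:
  fixes f :: "real \<Rightarrow> real"
  assumes "mono_on {0..} f" "0 \<le> t"
  obtains L where "(f \<longlongrightarrow> L) (at_right t)" "f t \<le> L" "\<And>u. t < u \<Longrightarrow> L \<le> f u"
proof -
  have mono: "f x \<le> f y" if "0 \<le> x" "x \<le> y" for x y
    using assms(1) that by (auto simp: mono_on_def)
  define L where "L = Inf (f ` ({t<..} \<inter> UNIV))"
  have L: "(f \<longlongrightarrow> L) (at_right t)"
    using Lim_right_bound[of UNIV t f "f t"] mono assms(2) by (simp add: L_def)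
  moreover have "f t \<le> L"
    unfolding L_def using mono assms(2) by (intro cInf_greatest) auto
  moreover have "L \<le> f u" if "t < u" for u
    unfolding L_def using mono assms(2) that
    by (intro cInf_lower) (auto simp: bdd_below_def intro!: exI[of _ "f t"])
  ultimately show ?thesis by (rule that)
qed

lemma mono_on_at_left_limit:
  fixes f :: "real \<Rightarrow> real"
  assumes "mono_on {0..} f" "0 < t"
  obtains L where "(f \<longlongrightarrow> L) (at_left t)" "L \<le> f t" "\<And>s. 0 \<le> s \<Longrightarrow> s < t \<Longrightarrow> f s \<le> L"
proof -
  define f' where "f' s = f (max 0 s)" for s
  have mono: "f x \<le> f y" if "0 \<le> x" "x \<le> y" for x y
    using assms(1) that by (auto simp: mono_on_def)
  have mono': "f' x \<le> f' y" if "x \<le> y" for x y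
    using mono[of "max 0 x" "max 0 y"] that by (auto simp: f'_def)
  define L where "L = Sup (f' ` ({..<t} \<inter> UNIV))"
  have "(f' \<longlongrightarrow> L) (at_left t)"
    using Lim_left_bound[of UNIV t f' "f' t"] mono' by (simp add: L_def)
  moreover have "eventually (\<lambda>s. f' s = f s) (at_left t)"
    using assms(2) by (auto simp: eventually_at_left[OF assms(2)] f'_def intro!: exI[of _ 0])
  ultimately have "(f \<longlongrightarrow> L) (at_left t)" by (rule Lim_transform_eventually)
  moreover have "L \<le> f t"
    unfolding L_def using mono'[of _ t] assms(2) by (intro cSup_least) (auto simp: f'_def)
  moreover have "f s \<le> L" if "0 \<le> s" "s < t" for s
  proof -
    have "f' s \<le> L"
      unfolding L_def using mono' that
      by (intro cSup_upper) (auto simp: bdd_above_def intro!: exI[of _ "f' t"])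
    then show ?thesis using that by (simp add: f'_def)
  qed
  ultimately show ?thesis by (rule that)
qed

lemma cadlagD_right: "cadlag X \<Longrightarrow> 0 \<le> t \<Longrightarrow> (X \<longlongrightarrow> X t) (at_right t)"
  by (simp add: cadlag_def continuous_within)

text \<open>A cadlag path is uniformly close to a step function, hence to a difference of two
  nondecreasing functions.\<close>

lemma cadlag_bounded_variation_band:
  assumes X: "cadlag X" and "c > 0" "0 \<le> T"
  obtains S K where "mono_on {0..T} S" "mono_on {0..T} K"
    "\<And>t. 0 \<le> t \<Longrightarrow> t \<le> T \<Longrightarrow> X t \<le> S t - K t \<and> S t - K t \<le> X t + c"
proof -
  \<comment> \<open>The proof is by bisection over intervals [a, b]. Cutting with
    \<open>{0..}\<close> is needed because the small intervals around the point 0 may reach to its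
    left, where nothing is known about X.\<close>
  define P where "P a b \<longleftrightarrow> (\<exists>S K :: real \<Rightarrow> real. mono_on ({a..b} \<inter> {0..}) S \<and> mono_on ({a..b} \<inter> {0..}) K \<and>
      (\<forall>t\<in>{a..b} \<inter> {0..}. X t \<le> S t - K t \<and> S t - K t \<le> X t + c))" for a b
  have "P 0 T"
    using \<open>0 \<le> T\<close>
  proof (induction rule: Bolzano)
    case (trans a b d)
    obtain S1 K1 where 1: "mono_on ({a..b} \<inter> {0..}) S1" "mono_on ({a..b} \<inter> {0..}) K1"
      "\<And>t. t\<in>{a..b} \<inter> {0..} \<Longrightarrow> X t \<le> S1 t - K1 t \<and> S1 t - K1 t \<le> X t + c"
      using trans(1) unfolding P_def by blast
    obtain S2 K2 where 2: "mono_on ({b..d} \<inter> {0..}) S2" "mono_on ({b..d} \<inter> {0..}) K2"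
      "\<And>t. t\<in>{b..d} \<inter> {0..} \<Longrightarrow> X t \<le> S2 t - K2 t \<and> S2 t - K2 t \<le> X t + c"
      using trans(2) unfolding P_def by blast
    \<comment> \<open>Shifting both components by the same C after b leaves their difference
      unchanged, and C is large enough to make both jumps at b nonnegative.\<close>
    define C where "C = \<bar>S1 b - S2 b\<bar> + \<bar>K1 b - K2 b\<bar>"
    define S where "S t = (if t \<le> b then S1 t else S2 t + C)" for t
    define K where "K t = (if t \<le> b then K1 t else K2 t + C)" for t
    have mono_glue: "mono_on ({a..d} \<inter> {0..}) (\<lambda>t. if t \<le> b then f t else g t + C)"
      if f: "mono_on ({a..b} \<inter> {0..}) f" and g: "mono_on ({b..d} \<inter> {0..}) g" and C: "f b \<le> g b + C"
      for f g :: "real \<Rightarrow> real"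
    proof (rule mono_onI)
      fix r s assume rs: "r \<in> {a..d} \<inter> {0..}" "s \<in> {a..d} \<inter> {0..}" "r \<le> s"
      consider "s \<le> b" | "r > b" | "r \<le> b" "b < s" by linarith
      then show "(if r \<le> b then f r else g r + C) \<le> (if s \<le> b then f s else g s + C)"
      proof cases
        case 1
        then show ?thesis using rs mono_onD[OF f, of r s] by simp
      next
        case 2
        then show ?thesis using rs mono_onD[OF g, of r s] by simp
      next
        case 3
        then show ?thesis
          using rs mono_onD[OF f, of r b] mono_onD[OF g, of b s] C trans(3,4) by simp
      qed
    qed
    have "mono_on ({a..d} \<inter> {0..}) S" "mono_on ({a..d} \<inter> {0..}) K"
      unfolding S_def K_def by (rule mono_glue; use 1 2 in \<open>auto simp: C_def\<close>)+
    moreover have "X t \<le> S t - K t \<and> S t - K t \<le> X t + c" if "t \<in> {a..d} \<inter> {0..}" for t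
      using 1(3)[of t] 2(3)[of t] that by (auto simp: S_def K_def)
    ultimately show ?case unfolding P_def by blast
  next
    case (local x)
    have "eventually (\<lambda>t. \<bar>X t - X x\<bar> < c / 2) (at_right x)"
      using tendstoD[OF cadlagD_right[OF X], of x "c / 2"] local \<open>c > 0\<close> by (simp add: dist_real_def)
    then obtain r where r: "r > x" "\<And>t. x < t \<Longrightarrow> t < r \<Longrightarrow> \<bar>X t - X x\<bar> < c / 2"
      by (auto simp: eventually_at_right_field)
    have "\<exists>l e. e < x \<and> (\<forall>t. 0 \<le> t \<and> e < t \<and> t < x \<longrightarrow> \<bar>X t - l\<bar> < c / 2)"
    proof (cases "x = 0")
      case False
      then have "x > 0" using local(1) by simp
      then obtain l where "(X \<longlongrightarrow> l) (at_left x)" using X unfolding cadlag_def by blast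
      from tendstoD[OF this, of "c / 2"] \<open>c > 0\<close>
      have "eventually (\<lambda>t. \<bar>X t - l\<bar> < c / 2) (at_left x)" by (simp add: dist_real_def)
      then show ?thesis by (auto simp: eventually_at_left_field)
    qed (auto intro!: exI[of _ "-1"])
    then obtain l e where e: "e < x" "\<And>t. 0 \<le> t \<Longrightarrow> e < t \<Longrightarrow> t < x \<Longrightarrow> \<bar>X t - l\<bar> < c / 2" by blast
    \<comment> \<open>The difference of S and K is to be \<open>l + c / 2\<close> before x and
      \<open>X x + c / 2\<close> from x on, which lies within c above X on each side. Adding D to
      both components at x makes each of them nondecreasing, since D dominates the increment of the
      difference in either direction.\<close>
    define D where "D = \<bar>X x - l\<bar>"
    define S where "S t = (if t < x then 0 else D)" for t
    define K where "K t = (if t < x then - (l + c / 2) else D - (X x + c / 2))" for t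
    have mono: "mono S" "mono K" by (auto simp: mono_def S_def K_def D_def)
    show ?case
    proof (intro exI[of _ "min (x - e) (r - x)"] conjI allI impI)
      show "0 < min (x - e) (r - x)" using e(1) r(1) by simp
      fix a b assume ab: "a \<le> x \<and> x \<le> b \<and> b - a < min (x - e) (r - x)"
      have "X t \<le> S t - K t \<and> S t - K t \<le> X t + c" if "t \<in> {a..b} \<inter> {0..}" for t
      proof -
        consider "t < x" | "t = x" | "t > x" by linarith
        then show ?thesis
        proof cases
          case 1
          then have "\<bar>X t - l\<bar> < c / 2" using e(2)[of t] that ab by auto
          then have "X t < l + c / 2" "l - c / 2 < X t" by linarith+
          then show ?thesis using 1 by (simp add: S_def K_def)
        next
          case 2
          then show ?thesis using \<open>c > 0\<close> by (simp add: S_def K_def)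
        next
          case 3
          then have "\<bar>X t - X x\<bar> < c / 2" using r(2)[of t] that ab by auto
          then have "X t < X x + c / 2" "X x - c / 2 < X t" by linarith+
          then show ?thesis using 3 by (simp add: S_def K_def)
        qed
      qed
      then show "P a b" unfolding P_def using mono by (blast intro: mono_on_subset)
    qed
  qed
  moreover have "{0..T} \<inter> {0..} = {0..T}" by auto
  ultimately obtain S K where "mono_on {0..T} S" "mono_on {0..T} K"
    "\<forall>t\<in>{0..T}. X t \<le> S t - K t \<and> S t - K t \<le> X t + c"
    unfolding P_def by metis
  then show ?thesis by (intro that[of S K]) auto
qed

lemma cadlag_bounded:
  assumes "cadlag X" "0 \<le> T"
  obtains B where "\<And>t. 0 \<le> t \<Longrightarrow> t \<le> T \<Longrightarrow> \<bar>X t\<bar> \<le> B"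
proof -
  obtain S K where SK: "mono_on {0..T} S" "mono_on {0..T} K"
    "\<And>t. 0 \<le> t \<Longrightarrow> t \<le> T \<Longrightarrow> X t \<le> S t - K t \<and> S t - K t \<le> X t + 1"
    using cadlag_bounded_variation_band[OF assms(1) _ assms(2), of 1] by auto
  show ?thesis
  proof (rule that)
    fix t assume "0 \<le> t" "t \<le> T"
    then show "\<bar>X t\<bar> \<le> \<bar>S 0\<bar> + \<bar>S T\<bar> + \<bar>K 0\<bar> + \<bar>K T\<bar> + 1"
      using SK(3)[of t] mono_onD[OF SK(1), of 0 t] mono_onD[OF SK(1), of t T]
        mono_onD[OF SK(2), of 0 t] mono_onD[OF SK(2), of t T] by (simp add: abs_le_iff) linarith
  qed
qed

lemma
  assumes "bdd_above (Y ` {0..max 0 t})"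
  shows runsup_upper: "0 \<le> s \<Longrightarrow> s \<le> t \<Longrightarrow> Y s \<le> runsup c Y t"
    and runsup_le_iff: "runsup c Y t \<le> u \<longleftrightarrow> c \<le> u \<and> (\<forall>s\<in>{0..max 0 t}. Y s \<le> u)"
  using assms
  by (auto simp: runsup_def cSUP_le_iff le_max_iff_disj intro: cSUP_upper)

text \<open>Here h is the flow of the tax ODE as a function of the level of the running supremum, so that
  g z is the tax collected until the running supremum reaches z.\<close>

locale tax_function =
  fixes h :: "real \<Rightarrow> real" and xbar :: real
  assumes xbar_nonneg: "0 \<le> xbar"
    and h_xbar: "h xbar = xbar"
    and h_strict: "xbar \<le> a \<Longrightarrow> a < b \<Longrightarrow> h a < h b"
    and h_lipschitz: "xbar \<le> a \<Longrightarrow> a \<le> b \<Longrightarrow> h b - h a \<le> b - a"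
begin

definition g :: "real \<Rightarrow> real" where "g z = z - h z"

lemma g_mono: "xbar \<le> a \<Longrightarrow> a \<le> b \<Longrightarrow> g a \<le> g b"
  using h_lipschitz by (force simp: g_def)

lemma g_strict_contraction: "xbar \<le> a \<Longrightarrow> a < b \<Longrightarrow> g b - g a < b - a"
  using h_strict by (force simp: g_def)

lemma g_contraction: "xbar \<le> a \<Longrightarrow> xbar \<le> b \<Longrightarrow> \<bar>g b - g a\<bar> \<le> \<bar>b - a\<bar>"
  using g_strict_contraction[of a b] g_strict_contraction[of b a] g_mono[of a b] g_mono[of b a]
  by (cases a b rule: linorder_cases) auto

lemma h_mono: "xbar \<le> a \<Longrightarrow> a \<le> b \<Longrightarrow> h a \<le> h b"
  using h_strict[of a b] by (cases "a = b") auto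

lemma g_less: "xbar < z \<Longrightarrow> g z < z"
  using h_strict[of xbar z] xbar_nonneg h_xbar by (simp add: g_def)

lemma tendsto_g:
  assumes "(f \<longlongrightarrow> l) F" "eventually (\<lambda>x. xbar \<le> f x) F" "xbar \<le> l"
  shows "((\<lambda>x. g (f x)) \<longlongrightarrow> g l) F"
proof (rule tendstoI)
  fix e :: real assume "e > 0"
  show "eventually (\<lambda>x. dist (g (f x)) (g l) < e) F"
    using tendstoD[OF assms(1) \<open>e > 0\<close>] assms(2)
  proof eventually_elim
    case (elim x)
    then show ?case using g_contraction[OF assms(3), of "f x"] by (simp add: dist_real_def)
  qed
qed

end

locale tax_path = tax_function +
  fixes X :: "real \<Rightarrow> real"
  assumes cadlag_X: "cadlag X" and no_pos_jumps_X: "no_pos_jumps X" and X_0: "X 0 \<le> xbar"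
begin

text \<open>In terms of h the last two inequalities read X <= S - K <= X + h(S). The horizon T is
  finite because supersolutions are produced only on compact intervals.\<close>

definition supersolution :: "real \<Rightarrow> (real \<Rightarrow> real) \<Rightarrow> (real \<Rightarrow> real) \<Rightarrow> bool" where
  "supersolution T K S \<longleftrightarrow> mono_on {0..T} K \<and> mono_on {0..T} S \<and>
     (\<forall>t\<in>{0..T}. 0 \<le> K t \<and> xbar \<le> S t \<and> g (S t) - X t \<le> K t \<and> X t + K t \<le> S t)"

text \<open>The two leastness clauses state, without forming a supremum, that K T is the running
  supremum of g(S) - X started at 0 and S T that of X + K started at xbar.\<close>

definition solution :: "(real \<Rightarrow> real) \<Rightarrow> (real \<Rightarrow> real) \<Rightarrow> bool" where
  "solution K S \<longleftrightarrow> (\<forall>T\<ge>0. supersolution T K S \<and>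
     (\<forall>u\<ge>0. (\<forall>s\<in>{0..T}. g (S s) - X s \<le> u) \<longrightarrow> K T \<le> u) \<and>
     (\<forall>u\<ge>xbar. (\<forall>s\<in>{0..T}. X s + K s \<le> u) \<longrightarrow> S T \<le> u))"

lemma supersolution_subset: "supersolution T K S \<Longrightarrow> T' \<le> T \<Longrightarrow> supersolution T' K S"
  by (auto simp: supersolution_def intro: mono_on_subset)

text \<open>Take the band of width \<open>c = h (xbar + 1)\<close> above X. Adding a common constant
  C to S and K preserves S - K and makes K nonnegative and S at least xbar + 1, so that h(S) >= c
  and the band fits between X and X + h(S).\<close>

lemma ex_supersolution:
  assumes "0 \<le> T"
  shows "\<exists>K S. supersolution T K S"
proof -
  define c where "c = h (xbar + 1)"
  have "c > 0" using h_strict[of xbar "xbar + 1"] xbar_nonneg h_xbar by (simp add: c_def)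
  obtain S K where SK: "mono_on {0..T} S" "mono_on {0..T} K"
    "\<And>t. 0 \<le> t \<Longrightarrow> t \<le> T \<Longrightarrow> X t \<le> S t - K t \<and> S t - K t \<le> X t + c"
    using cadlag_bounded_variation_band[OF cadlag_X \<open>c > 0\<close> assms] by blast
  define C where "C = \<bar>S 0\<bar> + \<bar>K 0\<bar> + xbar + 1"
  have "supersolution T (\<lambda>t. K t + C) (\<lambda>t. S t + C)"
    unfolding supersolution_def
  proof (intro conjI ballI)
    show "mono_on {0..T} (\<lambda>t. K t + C)" "mono_on {0..T} (\<lambda>t. S t + C)"
      using SK by (auto simp: mono_on_def)
    fix t assume t: "t \<in> {0..T}"
    have "S 0 \<le> S t" "K 0 \<le> K t"
      using t mono_onD[OF SK(1), of 0 t] mono_onD[OF SK(2), of 0 t] by auto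
    then have ge: "0 \<le> K t + C" "xbar + 1 \<le> S t + C" using xbar_nonneg by (auto simp: C_def)
    then show "0 \<le> K t + C" "xbar \<le> S t + C" by auto
    have "c \<le> h (S t + C)" using h_mono[of "xbar + 1" "S t + C"] ge by (simp add: c_def)
    then show "g (S t + C) - X t \<le> K t + C" "X t + (K t + C) \<le> S t + C"
      using SK(3)[of t] t by (auto simp: g_def)
  qed
  then show ?thesis by blast
qed

text \<open>The least supersolution is a solution: truncating one of its two components at an upper bound u
  of the corresponding path yields another supersolution.\<close>

lemma ex_solution: "\<exists>K S. solution K S"
proof -
  \<comment> \<open>The value at t is an infimum over all supersolutions with horizon exactly t.
    Monotonicity of the infima holds because a supersolution up to s restricts to one up to every r
    <= s.\<close>
  define AK where "AK t = {K t | K S. supersolution t K S}" for t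
  define AS where "AS t = {S t | K S. supersolution t K S}" for t
  define K where "K t = Inf (AK t)" for t
  define S where "S t = Inf (AS t)" for t
  have ne: "AK t \<noteq> {}" "AS t \<noteq> {}" if "0 \<le> t" for t
    using ex_supersolution[OF that] by (auto simp: AK_def AS_def)
  have K_le: "K t \<le> K' t" and S_le: "S t \<le> S' t" if "supersolution t K' S'" "0 \<le> t" for K' S' t
  proof -
    have "bdd_below (AK t)"
      using that(2) by (auto simp: AK_def supersolution_def intro!: bdd_belowI[of _ 0])
    moreover have "bdd_below (AS t)"
      using that(2) by (auto simp: AS_def supersolution_def intro!: bdd_belowI[of _ xbar])
    ultimately show "K t \<le> K' t" "S t \<le> S' t"
      using that by (auto simp: K_def S_def AK_def AS_def intro!: cInf_lower)
  qed
  have K_ge: "u \<le> K t" if "\<And>K' S'. supersolution t K' S' \<Longrightarrow> u \<le> K' t" "0 \<le> t" for u t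
    unfolding K_def using ne[OF that(2)] that(1) by (intro cInf_greatest) (auto simp: AK_def)
  have S_ge: "u \<le> S t" if "\<And>K' S'. supersolution t K' S' \<Longrightarrow> u \<le> S' t" "0 \<le> t" for u t
    unfolding S_def using ne[OF that(2)] that(1) by (intro cInf_greatest) (auto simp: AS_def)
  have super: "supersolution T K S" for T
    unfolding supersolution_def
  proof (intro conjI ballI mono_onI)
    fix r s assume rs: "r \<in> {0..T}" "s \<in> {0..T}" "r \<le> s"
    have *: "supersolution r K' S' \<and> K' r \<le> K' s \<and> S' r \<le> S' s" if "supersolution s K' S'" for K' S'
      using that rs supersolution_subset[OF that rs(3)] by (auto simp: supersolution_def mono_on_def)
    show "K r \<le> K s" using rs * K_le by (intro K_ge) (force+)
    show "S r \<le> S s" using rs * S_le by (intro S_ge) (force+)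
  next
    fix t assume t: "t \<in> {0..T}"
    then have t0: "0 \<le> t" by simp
    show "0 \<le> K t" using t by (intro K_ge) (auto simp: supersolution_def)
    show xS: "xbar \<le> S t" using t by (intro S_ge) (auto simp: supersolution_def)
    \<comment> \<open>K and S are separate infima and need not come from one pair. Monotonicity of g
      bridges this: \<open>S t \<le> S' t\<close> lets the inequality of each pair pass to the
      infimum S.\<close>
    have "g (S t) - X t \<le> K' t" if "supersolution t K' S'" for K' S'
      using g_mono[OF xS S_le[OF that t0]] that t by (force simp: supersolution_def)
    then show "g (S t) - X t \<le> K t" by (rule K_ge[OF _ t0])
    have "X t + K t \<le> S' t" if "supersolution t K' S'" for K' S'
      using K_le[OF that t0] that t by (force simp: supersolution_def)
    then show "X t + K t \<le> S t" by (rule S_ge[OF _ t0])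
  qed
  have "solution K S"
    unfolding solution_def
  proof (intro allI impI conjI super)
    fix T u :: real assume "0 \<le> T" "0 \<le> u" "\<forall>s\<in>{0..T}. g (S s) - X s \<le> u"
    then have "supersolution T (\<lambda>t. min (K t) u) S"
      using super[of T] by (force simp: supersolution_def mono_on_def min_le_iff_disj)
    from K_le[OF this \<open>0 \<le> T\<close>] show "K T \<le> u" by simp
  next
    fix T u :: real assume u: "0 \<le> T" "xbar \<le> u" "\<forall>s\<in>{0..T}. X s + K s \<le> u"
    have "supersolution T K (\<lambda>t. min (S t) u)"
      unfolding supersolution_def
    proof (intro conjI ballI)
      show "mono_on {0..T} K" using super[of T] by (simp add: supersolution_def)
      show "mono_on {0..T} (\<lambda>t. min (S t) u)"
        using super[of T] by (force simp: supersolution_def mono_on_def min_le_iff_disj)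
      fix t assume t: "t \<in> {0..T}"
      then have s: "0 \<le> K t" "xbar \<le> S t" "g (S t) - X t \<le> K t" "X t + K t \<le> S t"
        using super[of T] by (auto simp: supersolution_def)
      then show "0 \<le> K t" "xbar \<le> min (S t) u" "X t + K t \<le> min (S t) u" using u t by auto
      show "g (min (S t) u) - X t \<le> K t"
        using g_mono[of "min (S t) u" "S t"] s u by auto
    qed
    from S_le[OF this \<open>0 \<le> T\<close>] show "S T \<le> u" by simp
  qed
  then show ?thesis by blast
qed

section \<open>Regularity of a solution and the times at which its components grow\<close>

context
  fixes K S assumes sol: "solution K S"
begin

lemma sol_mono: "mono_on {0..} K" "mono_on {0..} S"
proof -
  have *: "mono_on {0..T} K" "mono_on {0..T} S" if "0 \<le> T" for T
    using sol that by (auto simp: solution_def supersolution_def)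
  show "mono_on {0..} K"
  proof (rule mono_onI)
    fix r s :: real assume "r \<in> {0..}" "s \<in> {0..}" "r \<le> s"
    then show "K r \<le> K s" using mono_onD[OF *(1)[of s], of r s] by simp
  qed
  show "mono_on {0..} S"
  proof (rule mono_onI)
    fix r s :: real assume "r \<in> {0..}" "s \<in> {0..}" "r \<le> s"
    then show "S r \<le> S s" using mono_onD[OF *(2)[of s], of r s] by simp
  qed
qed

lemma sol_monoD: "0 \<le> s \<Longrightarrow> s \<le> t \<Longrightarrow> K s \<le> K t" "0 \<le> s \<Longrightarrow> s \<le> t \<Longrightarrow> S s \<le> S t"
  using sol_mono by (auto simp: mono_on_def)

lemma
  assumes "0 \<le> t"
  shows sol_K_nonneg: "0 \<le> K t" and sol_S_ge: "xbar \<le> S t"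
    and sol_K_ge: "g (S t) - X t \<le> K t" and sol_S_ge_sum: "X t + K t \<le> S t"
  using sol assms by (auto simp: solution_def supersolution_def)

lemma sol_K_le: "0 \<le> t \<Longrightarrow> 0 \<le> u \<Longrightarrow> (\<And>s. 0 \<le> s \<Longrightarrow> s \<le> t \<Longrightarrow> g (S s) - X s \<le> u) \<Longrightarrow> K t \<le> u"
  using sol by (auto simp: solution_def)

lemma sol_S_le: "0 \<le> t \<Longrightarrow> xbar \<le> u \<Longrightarrow> (\<And>s. 0 \<le> s \<Longrightarrow> s \<le> t \<Longrightarrow> X s + K s \<le> u) \<Longrightarrow> S t \<le> u"
  using sol by (auto simp: solution_def)

text \<open>The feedback argument in its simplest form: if S 0 exceeds xbar, then S 0 <= X 0 + K 0
  and, as K 0 > 0, K 0 <= g(S 0) - X 0. Together S 0 <= g(S 0), contrary to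
  \<open>g_less\<close>.\<close>

lemma sol_S_0: "S 0 = xbar"
proof (rule ccontr)
  assume "S 0 \<noteq> xbar"
  then have lt: "xbar < S 0" using sol_S_ge[of 0] by simp
  have "S 0 \<le> max xbar (X 0 + K 0)" by (rule sol_S_le) auto
  moreover have "K 0 \<le> max 0 (g (S 0) - X 0)" by (rule sol_K_le) auto
  ultimately show False using lt g_less[OF lt] X_0 by (auto simp: max_def split: if_splits)
qed

text \<open>The right limits Sp and Kp obey the same two bounds as the values, because X is
  right-continuous. A jump of S would therefore give Sp <= X t + Kp and Kp <= g(Sp) - X t, that is
  Sp <= g(Sp). Once S does not jump, the bound on Kp rules out a jump of K.\<close>

lemma sol_right_continuous:
  assumes "0 \<le> t"
  shows "(S \<longlongrightarrow> S t) (at_right t)" "(K \<longlongrightarrow> K t) (at_right t)"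
proof -
  obtain Kp where Kp: "(K \<longlongrightarrow> Kp) (at_right t)" "K t \<le> Kp" "\<And>u. t < u \<Longrightarrow> Kp \<le> K u"
    using mono_on_at_right_limit[OF sol_mono(1) assms] by blast
  obtain Sp where Sp: "(S \<longlongrightarrow> Sp) (at_right t)" "S t \<le> Sp" "\<And>u. t < u \<Longrightarrow> Sp \<le> S u"
    using mono_on_at_right_limit[OF sol_mono(2) assms] by blast
  have Xr: "(X \<longlongrightarrow> X t) (at_right t)" by (rule cadlagD_right[OF cadlag_X assms])
  have xSp: "xbar \<le> Sp" using Sp(2) sol_S_ge[OF assms] by simp
  have S_bound: "Sp \<le> max (S t) (X t + Kp)"
  proof (rule field_le_epsilon)
    fix e :: real assume "e > 0"
    have "((\<lambda>s. X s + K s) \<longlongrightarrow> X t + Kp) (at_right t)" by (intro tendsto_add Xr Kp)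
    then have "eventually (\<lambda>s. X s + K s < X t + Kp + e) (at_right t)"
      using \<open>e > 0\<close> by (intro order_tendstoD) auto
    then obtain b where b: "t < b" "\<And>s. t < s \<Longrightarrow> s < b \<Longrightarrow> X s + K s < X t + Kp + e"
      by (auto simp: eventually_at_right_field)
    define u where "u = (t + b) / 2"
    have u: "t < u" "u < b" using b(1) by (auto simp: u_def)
    have "S u \<le> max (S t) (X t + Kp) + e"
    proof (rule sol_S_le)
      fix s assume s: "0 \<le> s" "s \<le> u"
      show "X s + K s \<le> max (S t) (X t + Kp) + e"
      proof (cases "s \<le> t")
        case True
        then show ?thesis
          using sol_S_ge_sum[OF s(1)] sol_monoD(2)[OF s(1) True] \<open>e > 0\<close> by (simp add: max_def)
      next
        case False
        then show ?thesis using b(2)[of s] s u by (simp add: max_def)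
      qed
    qed (use u assms sol_S_ge[OF assms] \<open>e > 0\<close> in \<open>auto simp: max_def\<close>)
    then show "Sp \<le> max (S t) (X t + Kp) + e" using Sp(3)[OF u(1)] by simp
  qed
  have K_bound: "Kp \<le> max (K t) (g Sp - X t)"
  proof (rule field_le_epsilon)
    fix e :: real assume "e > 0"
    have "((\<lambda>s. g (S s) - X s) \<longlongrightarrow> g Sp - X t) (at_right t)"
    proof (intro tendsto_diff Xr tendsto_g Sp xSp)
      show "eventually (\<lambda>s. xbar \<le> S s) (at_right t)"
        using eventually_at_right_less[of t] by eventually_elim (use assms sol_S_ge in auto)
    qed
    then have "eventually (\<lambda>s. g (S s) - X s < g Sp - X t + e) (at_right t)"
      using \<open>e > 0\<close> by (intro order_tendstoD) auto
    then obtain b where b: "t < b" "\<And>s. t < s \<Longrightarrow> s < b \<Longrightarrow> g (S s) - X s < g Sp - X t + e"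
      by (auto simp: eventually_at_right_field)
    define u where "u = (t + b) / 2"
    have u: "t < u" "u < b" using b(1) by (auto simp: u_def)
    have "K u \<le> max (K t) (g Sp - X t) + e"
    proof (rule sol_K_le)
      fix s assume s: "0 \<le> s" "s \<le> u"
      show "g (S s) - X s \<le> max (K t) (g Sp - X t) + e"
      proof (cases "s \<le> t")
        case True
        then show ?thesis
          using sol_K_ge[OF s(1)] sol_monoD(1)[OF s(1) True] \<open>e > 0\<close> by (simp add: max_def)
      next
        case False
        then show ?thesis using b(2)[of s] s u by (simp add: max_def)
      qed
    qed (use u assms sol_K_nonneg[OF assms] \<open>e > 0\<close> in \<open>auto simp: max_def\<close>)
    then show "Kp \<le> max (K t) (g Sp - X t) + e" using Kp(3)[OF u(1)] by simp
  qed
  have SpS: "Sp = S t"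
  proof (rule ccontr)
    assume "Sp \<noteq> S t"
    then have "S t < Sp" using Sp(2) by simp
    moreover have "g Sp < Sp" using \<open>S t < Sp\<close> sol_S_ge[OF assms] by (intro g_less) simp
    ultimately show False
      using S_bound K_bound sol_S_ge_sum[OF assms] by (auto simp: max_def split: if_splits)
  qed
  moreover have "Kp = K t"
    using K_bound SpS Kp(2) sol_K_ge[OF assms] by (auto simp: max_def split: if_splits)
  ultimately show "(S \<longlongrightarrow> S t) (at_right t)" "(K \<longlongrightarrow> K t) (at_right t)"
    using Sp(1) Kp(1) by auto
qed

text \<open>Among the constraints defining K t only the one at time t itself is new, so an upward
  jump of K must land on g(S t) - X t.\<close>

lemma sol_K_le_left_limit:
  assumes "0 < t" "\<And>s. 0 \<le> s \<Longrightarrow> s < t \<Longrightarrow> K s \<le> L"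
  shows "K t \<le> max L (g (S t) - X t)"
proof (rule sol_K_le)
  show "0 \<le> max L (g (S t) - X t)"
    using assms(2)[of 0] assms(1) sol_K_nonneg[of 0] by (simp add: max_def)
  fix s assume "0 \<le> s" "s \<le> t"
  then show "g (S s) - X s \<le> max L (g (S t) - X t)"
    using sol_K_ge[of s] assms(2)[of s] by (cases "s = t") auto
qed (use assms in auto)

text \<open>Suppose S jumps at t, so that S t <= X t + K t. If K does not jump, this is at most X t
  + Km <= l + Km <= Sm, because X has no upward jump. If K jumps, it lands on g(S t) - X t and S t
  <= g(S t).\<close>

lemma sol_S_left_continuous:
  assumes "0 < t"
  shows "(S \<longlongrightarrow> S t) (at_left t)"
proof -
  obtain Km where Km: "(K \<longlongrightarrow> Km) (at_left t)" "Km \<le> K t" "\<And>s. 0 \<le> s \<Longrightarrow> s < t \<Longrightarrow> K s \<le> Km"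
    using mono_on_at_left_limit[OF sol_mono(1) assms] by blast
  obtain Sm where Sm: "(S \<longlongrightarrow> Sm) (at_left t)" "Sm \<le> S t" "\<And>s. 0 \<le> s \<Longrightarrow> s < t \<Longrightarrow> S s \<le> Sm"
    using mono_on_at_left_limit[OF sol_mono(2) assms] by blast
  obtain l where l: "(X \<longlongrightarrow> l) (at_left t)" using cadlag_X assms by (auto simp: cadlag_def)
  have Xl: "X t \<le> l" using no_pos_jumps_X assms tendsto_Lim[OF _ l] by (force simp: no_pos_jumps_def)
  have ev: "eventually (\<lambda>s. 0 \<le> s) (at_left t)"
    using eventually_at_left_real[OF assms] by eventually_elim auto
  have lim: "l + Km \<le> Sm"
    by (rule tendsto_le[OF _ Sm(1) tendsto_add[OF l Km(1)]])
       (use ev in \<open>auto elim!: eventually_mono intro: sol_S_ge_sum\<close>)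
  have xSm: "xbar \<le> Sm" using Sm(3)[of 0] assms sol_S_ge[of 0] by simp
  have S_bound: "S t \<le> max Sm (X t + K t)"
  proof (rule sol_S_le)
    fix s assume "0 \<le> s" "s \<le> t"
    then show "X s + K s \<le> max Sm (X t + K t)"
      using sol_S_ge_sum[of s] Sm(3)[of s] by (cases "s = t") auto
  qed (use assms xSm in auto)
  have "S t = Sm"
  proof (rule ccontr)
    assume "S t \<noteq> Sm"
    then have "Sm < S t" using Sm(2) by simp
    then have "g (S t) < S t" using xSm by (intro g_less) simp
    with \<open>Sm < S t\<close> show False
      using sol_K_le_left_limit[OF assms Km(3)] S_bound Xl lim by (auto simp: max_def split: if_splits)
  qed
  then show ?thesis using Sm(1) by simp
qed

lemma sol_S_continuous_on: "continuous_on {0..} S"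
proof (rule continuous_on_eq_continuous_within[THEN iffD2], intro ballI)
  fix t :: real assume "t \<in> {0..}"
  then have t: "0 \<le> t" by simp
  show "continuous (at t within {0..}) S"
  proof (cases "t = 0")
    case True
    then have "at t within {0..} = at_right t" by (simp add: at_within_Ici_at_right)
    then show ?thesis using sol_right_continuous(1)[OF t] by (simp add: continuous_within)
  next
    case False
    then have "isCont S t"
      using sol_right_continuous(1)[OF t] sol_S_left_continuous[of t] t
      by (simp add: isCont_def filterlim_split_at)
    then show ?thesis by (rule continuous_at_imp_continuous_at_within)
  qed
qed

lemma cadlag_sol_K: "cadlag K"
  unfolding cadlag_def
proof (intro conjI allI impI)
  show "continuous (at_right t) K" if "0 \<le> t" for t
    using sol_right_continuous(2)[OF that] by (simp add: continuous_within)
  show "\<exists>l. (K \<longlongrightarrow> l) (at_left t)" if "0 < t" for t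
    using mono_on_at_left_limit[OF sol_mono(1) that] by metis
qed

lemma runsup_sol:
  assumes "0 \<le> t"
  shows "runsup xbar (\<lambda>s. X s + K s) t = S t"
proof (rule antisym)
  have bdd: "bdd_above ((\<lambda>s. X s + K s) ` {0..max 0 t})"
  proof (rule bdd_aboveI2)
    fix s assume "s \<in> {0..max 0 t}"
    then show "X s + K s \<le> S t" using sol_S_ge_sum[of s] sol_monoD(2)[of s t] assms by auto
  qed
  show "S t \<le> runsup xbar (\<lambda>s. X s + K s) t"
    using assms runsup_upper[OF bdd] by (intro sol_S_le) (auto simp: runsup_def)
  have "X s + K s \<le> S t" if "s \<in> {0..t}" for s
    using sol_S_ge_sum[of s] sol_monoD(2)[of s t] that by auto
  then show "runsup xbar (\<lambda>s. X s + K s) t \<le> S t"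
    using runsup_le_iff[OF bdd] assms sol_S_ge[OF assms] by simp
qed

text \<open>By right continuity X + K stays below the level S t for a while, so the supremum is not
  renewed. With \<open>AE_interval_measure_not_flat\<close> this places dS on the times where X + K
  = S.\<close>

lemma sol_S_flat:
  assumes "0 \<le> t" "X t + K t < S t"
  shows "\<exists>u>t. S u = S t"
proof -
  have "((\<lambda>s. X s + K s) \<longlongrightarrow> X t + K t) (at_right t)"
    by (intro tendsto_add cadlagD_right[OF cadlag_X assms(1)] sol_right_continuous(2)[OF assms(1)])
  then have "eventually (\<lambda>s. X s + K s < S t) (at_right t)"
    using assms(2) by (rule order_tendstoD)
  then obtain b where b: "t < b" "\<And>s. t < s \<Longrightarrow> s < b \<Longrightarrow> X s + K s < S t"
    by (auto simp: eventually_at_right_field)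
  define u where "u = (t + b) / 2"
  have u: "t < u" "u < b" using b(1) by (auto simp: u_def)
  have "S u \<le> S t"
  proof (rule sol_S_le)
    fix s assume s: "0 \<le> s" "s \<le> u"
    show "X s + K s \<le> S t"
    proof (cases "s \<le> t")
      case True
      then show ?thesis using sol_S_ge_sum[OF s(1)] sol_monoD(2)[OF s(1) True] by simp
    next
      case False
      then show ?thesis using b(2)[of s] s u by simp
    qed
  qed (use u assms sol_S_ge[of t] in auto)
  then show ?thesis using u sol_monoD(2)[of t u] assms by (intro exI[of _ u]) auto
qed

text \<open>The counterpart for K, which places dK on the times where V = X + K - g(S) vanishes,
  except for possible jumps of K.\<close>

lemma sol_K_flat:
  assumes "0 \<le> t" "g (S t) - X t < K t"
  shows "\<exists>u>t. K u = K t"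
proof -
  have "((\<lambda>s. g (S s) - X s) \<longlongrightarrow> g (S t) - X t) (at_right t)"
  proof (intro tendsto_diff cadlagD_right[OF cadlag_X assms(1)] tendsto_g
      sol_right_continuous(1)[OF assms(1)] sol_S_ge[OF assms(1)])
    show "eventually (\<lambda>s. xbar \<le> S s) (at_right t)"
      using eventually_at_right_less[of t] by eventually_elim (use assms sol_S_ge in auto)
  qed
  then have "eventually (\<lambda>s. g (S s) - X s < K t) (at_right t)"
    using assms(2) by (rule order_tendstoD)
  then obtain b where b: "t < b" "\<And>s. t < s \<Longrightarrow> s < b \<Longrightarrow> g (S s) - X s < K t"
    by (auto simp: eventually_at_right_field)
  define u where "u = (t + b) / 2"
  have u: "t < u" "u < b" using b(1) by (auto simp: u_def)
  have "K u \<le> K t"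
  proof (rule sol_K_le)
    fix s assume s: "0 \<le> s" "s \<le> u"
    show "g (S s) - X s \<le> K t"
    proof (cases "s \<le> t")
      case True
      then show ?thesis using sol_K_ge[OF s(1)] sol_monoD(1)[OF s(1) True] by simp
    next
      case False
      then show ?thesis using b(2)[of s] s u by simp
    qed
  qed (use u assms sol_K_nonneg[of t] in auto)
  then show ?thesis using u sol_monoD(1)[of t u] assms by (intro exI[of _ u]) auto
qed

end

text \<open>An error D in the collected tax passes to K and from K to S without amplification, since
  both are running suprema.\<close>

lemma solution_le:
  assumes sol: "solution K S" "solution K' S'" and "0 \<le> D"
    and D: "\<And>s. 0 \<le> s \<Longrightarrow> s \<le> T \<Longrightarrow> g (S s) \<le> g (S' s) + D" and t: "0 \<le> t" "t \<le> T"
  shows "K t \<le> K' t + D" "S t \<le> S' t + D"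
proof -
  have K: "K t \<le> K' t + D" if t: "0 \<le> t" "t \<le> T" for t
  proof (rule sol_K_le[OF sol(1)])
    show "0 \<le> K' t + D" using sol_K_nonneg[OF sol(2) t(1)] \<open>0 \<le> D\<close> by simp
    fix s assume s: "0 \<le> s" "s \<le> t"
    then show "g (S s) - X s \<le> K' t + D"
      using D[of s] sol_K_ge[OF sol(2), of s] sol_monoD(1)[OF sol(2), of s t] t by simp
  qed (rule t)
  then show "K t \<le> K' t + D" using t by blast
  show "S t \<le> S' t + D"
  proof (rule sol_S_le[OF sol(1)])
    show "xbar \<le> S' t + D" using sol_S_ge[OF sol(2) t(1)] \<open>0 \<le> D\<close> by simp
    fix s assume s: "0 \<le> s" "s \<le> t"
    then show "X s + K s \<le> S' t + D"
      using K[of s] sol_S_ge_sum[OF sol(2), of s] sol_monoD(2)[OF sol(2), of s t] t by simp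
  qed (rule t)
qed

text \<open>Although the tax function g need not have a Lipschitz constant below 1, it is strictly
  contracting at the point where the difference of the collected taxes is maximal.\<close>

lemma solution_unique:
  assumes sol: "solution K S" "solution K' S'" and "0 \<le> t"
  shows "K t = K' t" "S t = S' t"
proof -
  define \<phi> where "\<phi> s = \<bar>g (S s) - g (S' s)\<bar>" for s
  have cont_g: "continuous_on {xbar..} g"
    unfolding continuous_on_def by (auto intro!: tendsto_g tendsto_ident_at simp: eventually_at_filter)
  have "continuous_on {0..t} (\<lambda>s. g (S s))" "continuous_on {0..t} (\<lambda>s. g (S' s))"
    using sol_S_ge[OF sol(1)] sol_S_ge[OF sol(2)]
    by (auto intro!: continuous_on_compose2[OF cont_g]
        continuous_on_subset[OF sol_S_continuous_on[OF sol(1)]]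
        continuous_on_subset[OF sol_S_continuous_on[OF sol(2)]])
  then have "continuous_on {0..t} \<phi>"
    unfolding \<phi>_def by (intro continuous_intros)
  then obtain m where m: "m \<in> {0..t}" "\<And>s. s \<in> {0..t} \<Longrightarrow> \<phi> s \<le> \<phi> m"
    using continuous_attains_sup[of "{0..t}" \<phi>] \<open>0 \<le> t\<close> by auto
  have le: "g (S s) \<le> g (S' s) + \<phi> m" "g (S' s) \<le> g (S s) + \<phi> m" if "0 \<le> s" "s \<le> t" for s
    using m(2)[of s] that by (auto simp: \<phi>_def)
  have "\<phi> m \<ge> 0" by (simp add: \<phi>_def)
  have le1: "K s \<le> K' s + \<phi> m" "S s \<le> S' s + \<phi> m"
    and le2: "K' s \<le> K s + \<phi> m" "S' s \<le> S s + \<phi> m" if "0 \<le> s" "s \<le> t" for s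
    using solution_le[OF sol \<open>\<phi> m \<ge> 0\<close>, of t s] solution_le[OF sol(2,1) \<open>\<phi> m \<ge> 0\<close>, of t s]
      le that by blast+
  have "S m = S' m"
  proof (rule ccontr)
    assume "S m \<noteq> S' m"
    \<comment> \<open>The strict contraction at m makes the gap between S m and S' m exceed
      \<open>\<phi> m\<close>, while \<open>le1\<close> and \<open>le2\<close> bound that gap by
      \<open>\<phi> m\<close>.\<close>
    then have "\<phi> m < \<bar>S m - S' m\<bar>"
      using g_strict_contraction[of "S m" "S' m"] g_strict_contraction[of "S' m" "S m"]
        g_mono[of "S m" "S' m"] g_mono[of "S' m" "S m"]
        sol_S_ge[OF sol(1), of m] sol_S_ge[OF sol(2), of m] m(1)
      by (cases "S m" "S' m" rule: linorder_cases) (auto simp: \<phi>_def)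
    then show False using le1(2)[of m] le2(2)[of m] m(1) by (simp add: abs_if split: if_splits)
  qed
  then have "\<phi> m = 0" by (simp add: \<phi>_def)
  then show "K t = K' t" "S t = S' t"
    using le1[of t] le2[of t] \<open>0 \<le> t\<close> by auto
qed

end

section \<open>The tax ODE\<close>

lemma continuous_on_max0:
  fixes f :: "real \<Rightarrow> real"
  assumes "continuous_on {0..} f"
  shows "continuous_on UNIV (\<lambda>t. f (max 0 t))"
  by (rule continuous_on_compose2[OF assms]) (auto intro!: continuous_intros)

lemma mono_max0:
  fixes f :: "real \<Rightarrow> real"
  assumes "mono_on {0..} f"
  shows "mono (\<lambda>t. f (max 0 t))"
  using assms by (auto simp: mono_def mono_on_def)

locale tax_ode =
  fixes \<delta> y :: "real \<Rightarrow> real" and xbar :: real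
  assumes meas: "set_borel_measurable borel {0..} \<delta>"
    and range: "\<forall>x\<ge>0. 0 \<le> \<delta> x \<and> \<delta> x < 1"
    and ode: "ode_solution \<delta> xbar y" and xbar_nonneg: "0 \<le> xbar"
begin

text \<open>Nothing is known about \<open>\<delta>\<close> on the negative half-line. Extending it
  by 0 gives a Borel function on the whole line for which \<open>p\<close> takes values in (0, 1]
  everywhere.\<close>

definition \<delta>\<^sub>0 :: "real \<Rightarrow> real" where "\<delta>\<^sub>0 x = indicator {0..} x * \<delta> x"
definition p :: "real \<Rightarrow> real" where "p x = 1 - \<delta>\<^sub>0 x"

lemma measurable_\<delta>\<^sub>0 [measurable]: "\<delta>\<^sub>0 \<in> borel_measurable borel"
  using meas by (simp add: set_borel_measurable_def \<delta>\<^sub>0_def[abs_def])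

lemma measurable_p [measurable]: "p \<in> borel_measurable borel"
  unfolding p_def[abs_def] by measurable

lemma \<delta>\<^sub>0_eq: "0 \<le> x \<Longrightarrow> \<delta>\<^sub>0 x = \<delta> x"
  by (simp add: \<delta>\<^sub>0_def)

lemma \<delta>\<^sub>0_range: "0 \<le> \<delta>\<^sub>0 x" "\<delta>\<^sub>0 x \<le> 1"
  using range by (auto simp: \<delta>\<^sub>0_def indicator_def less_imp_le)

lemma p_range: "0 < p x" "p x \<le> 1"
  using range \<delta>\<^sub>0_range by (auto simp: p_def \<delta>\<^sub>0_def indicator_def)

lemma y_0: "y 0 = xbar" and y_nonneg: "0 \<le> t \<Longrightarrow> 0 \<le> y t"
  using ode by (auto simp: ode_solution_def)

lemma has_integral_y:
  assumes "0 \<le> a" "a \<le> b"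
  shows "((\<lambda>t. p (y t)) has_integral (y b - y a)) {a..b}"
proof -
  have "AE t in lborel. t \<ge> 0 \<longrightarrow> (y has_real_derivative (1 - \<delta> (y t))) (at t)"
    using ode by (simp add: ode_solution_def)
  then obtain N where N: "N \<in> null_sets lborel"
    "{t. \<not> (t \<ge> 0 \<longrightarrow> (y has_real_derivative (1 - \<delta> (y t))) (at t))} \<subseteq> N"
    by (auto elim!: AE_E simp: null_sets_def)
  have ac: "abs_cont_on_interval a b y"
  proof (rule abs_cont_on_interval_subset[of 0 b])
    show "abs_cont_on_interval 0 b y"
      using ode assms by (auto simp: ode_solution_def abs_cont_nonneg_def)
  qed (use assms in auto)
  show ?thesis
  proof (rule fundamental_theorem_of_calculus_abs_cont[OF assms(2) ac])
    show "negligible N" using N(1) by (simp add: negligible_iff_null_sets null_sets_completionI)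
    fix x assume x: "x \<in> {a..b} - N"
    then have "\<not> \<not> (y has_real_derivative (1 - \<delta> (y x))) (at x)"
      using subsetD[OF N(2), of x] assms by auto
    then have "(y has_real_derivative (1 - \<delta> (y x))) (at x)" by simp
    moreover have "1 - \<delta> (y x) = p (y x)" using y_nonneg[of x] x assms by (simp add: p_def \<delta>\<^sub>0_eq)
    ultimately show "(y has_real_derivative p (y x)) (at x within {a..b})"
      using DERIV_subset[of y "p (y x)" x UNIV] by simp
  qed
qed

lemma y_mono: "0 \<le> a \<Longrightarrow> a \<le> b \<Longrightarrow> y a \<le> y b"
  using has_integral_nonneg[OF has_integral_y[of a b]] p_range by (simp add: less_imp_le)

lemma y_lipschitz: "0 \<le> a \<Longrightarrow> a \<le> b \<Longrightarrow> y b - y a \<le> b - a"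
  using has_integral_le[OF has_integral_y[of a b] has_integral_const_real[of 1 a b]] p_range by simp

lemma continuous_on_y: "continuous_on {0..} y"
proof (rule lipschitz_on_continuous_on)
  show "1-lipschitz_on {0..} y"
  proof (rule lipschitz_onI)
    fix a b :: real assume "a \<in> {0..}" "b \<in> {0..}"
    then show "dist (y a) (y b) \<le> 1 * dist a b"
      using y_mono[of a b] y_mono[of b a] y_lipschitz[of a b] y_lipschitz[of b a]
      by (cases "a \<le> b") (auto simp: dist_real_def)
  qed simp
qed

definition y\<^sub>0 :: "real \<Rightarrow> real" where "y\<^sub>0 t = y (max 0 t)"

lemma continuous_on_y\<^sub>0: "continuous_on UNIV y\<^sub>0"
  unfolding y\<^sub>0_def[abs_def] by (rule continuous_on_max0[OF continuous_on_y])

lemma mono_y\<^sub>0: "mono y\<^sub>0"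
  unfolding y\<^sub>0_def[abs_def] by (rule mono_max0) (auto intro: mono_onI y_mono)

lemma measurable_y\<^sub>0 [measurable]: "y\<^sub>0 \<in> borel_measurable borel"
  using continuous_on_y\<^sub>0 by (rule borel_measurable_continuous_onI)

lemma nn_integral_y:
  assumes "0 \<le> a" "a \<le> b"
  shows "(\<integral>\<^sup>+t\<in>{a<..b}. ennreal (p (y\<^sub>0 t)) \<partial>lborel) = ennreal (y b - y a)"
proof -
  have "((\<lambda>t. p (y\<^sub>0 t)) has_integral (y b - y a)) {a..b}"
    using has_integral_y[OF assms] by (rule has_integral_eq[rotated]) (use assms in \<open>auto simp: y\<^sub>0_def\<close>)
  then have "(\<integral>\<^sup>+t. ennreal (indicator {a..b} t * p (y\<^sub>0 t)) \<partial>lborel) = ennreal (y b - y a)"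
    using p_range by (intro nn_integral_has_integral_lebesgue) (auto intro: less_imp_le)
  moreover have "(\<integral>\<^sup>+t\<in>{a<..b}. ennreal (p (y\<^sub>0 t)) \<partial>lborel)
      = (\<integral>\<^sup>+t. ennreal (indicator {a..b} t * p (y\<^sub>0 t)) \<partial>lborel)"
  proof (rule nn_integral_cong_AE)
    show "AE t in lborel. ennreal (p (y\<^sub>0 t)) * indicator {a<..b} t = ennreal (indicator {a..b} t * p (y\<^sub>0 t))"
      using AE_lborel_singleton[of a] by eventually_elim (auto simp: indicator_def)
  qed
  ultimately show ?thesis by simp
qed

lemma y_strict_mono:
  assumes "0 \<le> a" "a < b"
  shows "y a < y b"
proof (rule ccontr)
  assume "\<not> y a < y b"
  then have "y b - y a = 0" using y_mono[of a b] assms by simp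
  then have "(\<integral>\<^sup>+t\<in>{a<..b}. ennreal (p (y\<^sub>0 t)) \<partial>lborel) = 0"
    using nn_integral_y[of a b] assms by simp
  then have "emeasure lborel {a<..b} = 0"
    by (rule set_nn_integral_pos_eq_0_imp_null) (use p_range in auto)
  then show False using assms by simp
qed

definition h :: "real \<Rightarrow> real" where "h z = y (z - xbar)"

text \<open>The integrated ODE shifted by xbar, so that the variable is the level of the running
  supremum rather than time. This is the integral that the change of time under S produces.\<close>

lemma nn_integral_h:
  assumes "xbar \<le> z"
  shows "(\<integral>\<^sup>+x\<in>{xbar<..z}. ennreal (p (y\<^sub>0 (x - xbar))) \<partial>lborel) = ennreal (h z - xbar)"
proof -
  have "(\<integral>\<^sup>+x\<in>{xbar<..z}. ennreal (p (y\<^sub>0 (x - xbar))) \<partial>lborel)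
      = (\<integral>\<^sup>+x. ennreal (p (y\<^sub>0 (x - xbar))) * indicator {xbar<..z} x \<partial>distr lborel borel ((+) xbar))"
    by (simp add: lborel_distr_plus)
  also have "\<dots> = (\<integral>\<^sup>+t. ennreal (p (y\<^sub>0 t)) * indicator {xbar<..z} (xbar + t) \<partial>lborel)"
    by (subst nn_integral_distr) auto
  also have "\<dots> = (\<integral>\<^sup>+t\<in>{0<..z - xbar}. ennreal (p (y\<^sub>0 t)) \<partial>lborel)"
    by (intro nn_integral_cong) (auto simp: indicator_def)
  also have "\<dots> = ennreal (h z - xbar)"
    using nn_integral_y[of 0 "z - xbar"] assms by (simp add: h_def y_0)
  finally show ?thesis .
qed

sublocale tax_function h xbar
proof
  show "h a < h b" if "xbar \<le> a" "a < b" for a b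
    using y_strict_mono[of "a - xbar" "b - xbar"] that by (simp add: h_def)
  show "h b - h a \<le> b - a" if "xbar \<le> a" "a \<le> b" for a b
    using y_lipschitz[of "a - xbar" "b - xbar"] that by (simp add: h_def)
qed (simp_all add: xbar_nonneg h_def y_0)

end

section \<open>The tax-reflection transform\<close>

lemma cadlag_measurable_max0:
  assumes "cadlag f"
  shows "(\<lambda>s. f (max 0 s)) \<in> borel_measurable borel"
  using assms
  by (intro borel_measurable_right_continuous continuous_at_right_max0) (auto simp: cadlag_def)

locale tax_setting = tax_ode +
  fixes X :: "real \<Rightarrow> real"
  assumes cadlag_X: "cadlag X" and no_pos_jumps_X: "no_pos_jumps X" and X_0: "X 0 \<le> xbar"
begin

sublocale tax_path h xbar X
  by unfold_locales (fact cadlag_X no_pos_jumps_X X_0)+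

lemma stieltjes_Ioc_\<delta>:
  assumes "\<forall>t\<ge>0. 0 \<le> V t"
  shows "stieltjes_Ioc (\<lambda>s. \<delta> (V s)) G t
    = (LINT s:{0<..t}|interval_measure (\<lambda>t. G (max 0 t)). \<delta>\<^sub>0 (V (max 0 s)))"
  unfolding stieltjes_Ioc_def LS_measure_def set_lebesgue_integral_def
  by (rule Bochner_Integration.integral_cong) (use assms in \<open>auto simp: indicator_def \<delta>\<^sub>0_eq\<close>)

text \<open>What must be shown is that the tax defined by the integral equals g(S), and that dK
  charges only V = 0. Both follow by locating the growth times of S and K.\<close>

lemma solution_imp_tax_reflection:
  assumes sol: "solution K S"
  shows "tax_reflection \<delta> xbar X (\<lambda>t. X t + K t - g (S t)) K"
proof -
  define V where "V t = X t + K t - g (S t)" for t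
  define S' where "S' t = S (max 0 t)" for t
  define K' where "K' t = K (max 0 t)" for t
  note mono = sol_mono[OF sol] and monoD = sol_monoD[OF sol] and S_ge = sol_S_ge[OF sol]
  have monoS': "mono S'" unfolding S'_def[abs_def] by (rule mono_max0[OF mono(2)])
  have contS': "continuous_on UNIV S'"
    unfolding S'_def[abs_def] by (rule continuous_on_max0[OF sol_S_continuous_on[OF sol]])
  have rcS': "continuous (at_right t) S'" and lcS': "continuous (at_left t) S'" for t
    using contS' by (simp_all add: continuous_on_eq_continuous_within continuous_at_imp_continuous_at_within)
  have monoK': "mono K'" unfolding K'_def[abs_def] by (rule mono_max0[OF mono(1)])
  have rcK': "continuous (at_right t) K'" for t
    unfolding K'_def[abs_def] using cadlag_sol_K[OF sol]
    by (intro continuous_at_right_max0) (simp add: cadlag_def)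
  have V_nonneg: "\<forall>t\<ge>0. 0 \<le> V t" using sol_K_ge[OF sol] by (force simp: V_def)
  have cadlag_V: "cadlag V"
    unfolding cadlag_def
  proof (intro conjI allI impI)
    fix t :: real assume t: "0 \<le> t"
    have "eventually (\<lambda>s. xbar \<le> S s) (at_right t)"
      using eventually_at_right_less[of t] by eventually_elim (use t S_ge in auto)
    then have "(V \<longlongrightarrow> V t) (at_right t)"
      unfolding V_def[abs_def]
      by (intro tendsto_diff tendsto_add tendsto_g sol_right_continuous[OF sol] cadlagD_right[OF cadlag_X]
          S_ge t)
    then show "continuous (at_right t) V" by (simp add: continuous_within)
  next
    fix t :: real assume t: "0 < t"
    have "eventually (\<lambda>s. xbar \<le> S s) (at_left t)"
      using eventually_at_left_real[OF t] by eventually_elim (use S_ge in auto)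
    then have "((\<lambda>s. g (S s)) \<longlongrightarrow> g (S t)) (at_left t)"
      using t by (intro tendsto_g sol_S_left_continuous[OF sol] S_ge) auto
    moreover obtain l where "(X \<longlongrightarrow> l) (at_left t)" using cadlag_X t unfolding cadlag_def by blast
    moreover obtain k where "(K \<longlongrightarrow> k) (at_left t)"
      using cadlag_sol_K[OF sol] t unfolding cadlag_def by blast
    ultimately have "(V \<longlongrightarrow> l + k - g (S t)) (at_left t)"
      unfolding V_def[abs_def] by (intro tendsto_diff tendsto_add)
    then show "\<exists>l. (V \<longlongrightarrow> l) (at_left t)" by blast
  qed
  note [measurable] = cadlag_measurable_max0[OF cadlag_V]
  have [measurable]: "S' \<in> borel_measurable borel" using monoS' by (rule borel_measurable_mono)
  have runsup: "(\<lambda>t. runsup xbar (\<lambda>s. X s + K s) (max 0 t)) = S'"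
    using runsup_sol[OF sol] by (auto simp: S'_def)
  have tax: "stieltjes_Ioc (\<lambda>s. \<delta> (V s)) (runsup xbar (\<lambda>s. X s + K s)) t = g (S t)"
    if t: "0 \<le> t" for t
  proof -
    \<comment> \<open>It is easier to compute the net amount S - xbar - D, the integral of p(V) dS.
      There V may be replaced by h(S) = y(S - xbar), and the change of time turns the integral into
      h(S t) - xbar.\<close>
    define D where "D = (LINT s:{0<..t}|interval_measure S'. \<delta>\<^sub>0 (V (max 0 s)))"
    have D: "D \<le> S t - xbar"
      "ennreal (S t - xbar - D) = (\<integral>\<^sup>+s\<in>{0<..t}. ennreal (p (V (max 0 s))) \<partial>interval_measure S')"
      using set_integral_interval_measure_complement(3,4)[OF monoS' rcS', of "\<lambda>s. \<delta>\<^sub>0 (V (max 0 s))" 0 t]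
        \<delta>\<^sub>0_range t sol_S_0[OF sol] by (simp_all add: D_def p_def S'_def)
    note D(2)
    also have "(\<integral>\<^sup>+s\<in>{0<..t}. ennreal (p (V (max 0 s))) \<partial>interval_measure S')
        = (\<integral>\<^sup>+s\<in>{0<..t}. ennreal (p (y\<^sub>0 (S' s - xbar))) \<partial>interval_measure S')"
    proof (rule nn_integral_cong_AE)
      show "AE s in interval_measure S'. ennreal (p (V (max 0 s))) * indicator {0<..t} s
          = ennreal (p (y\<^sub>0 (S' s - xbar))) * indicator {0<..t} s"
        using AE_interval_measure_not_flat[OF monoS' rcS']
      proof eventually_elim
        case (elim s)
        show ?case
        proof (cases "s \<in> {0<..t}")
          case True
          then have s: "0 \<le> s" by simp
          have "\<not> X s + K s < S s"
          proof
            assume "X s + K s < S s"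
            then obtain u where "u > s" "S u = S s" using sol_S_flat[OF sol s] by blast
            then have "S' u = S' s" using s by (simp add: S'_def)
            with elim lcS' \<open>u > s\<close> show False by blast
          qed
          then have "V s = h (S s)"
            using sol_S_ge_sum[OF sol s] by (simp add: V_def g_def)
          then show ?thesis using s S_ge[OF s] by (simp add: h_def S'_def y\<^sub>0_def)
        qed simp
      qed
    qed
    also have "\<dots> = (\<integral>\<^sup>+x\<in>{S' 0<..S' t}. ennreal (p (y\<^sub>0 (x - xbar))) \<partial>lborel)"
      by (rule nn_integral_interval_measure_change_time[OF monoS' contS' t]) measurable
    also have "\<dots> = ennreal (h (S t) - xbar)"
      using nn_integral_h[OF S_ge[OF t]] t sol_S_0[OF sol] by (simp add: S'_def)
    finally have "S t - xbar - D = h (S t) - xbar"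
      using D(1) h_mono[OF _ S_ge[OF t]] h_xbar by (subst (asm) ennreal_inj) auto
    then show ?thesis
      unfolding stieltjes_Ioc_\<delta>[OF V_nonneg] runsup by (simp add: D_def g_def)
  qed
  have "stieltjes_nn_0_inf (\<lambda>s. indicator {0<..} (V s)) K = 0"
  proof -
    have "indicator {0<..} (V 0) * K 0 \<le> 0"
    proof (cases "V 0 > 0")
      case True
      then have "g (S 0) - X 0 < K 0" by (simp add: V_def)
      moreover have "K 0 \<le> max 0 (g (S 0) - X 0)" by (rule sol_K_le[OF sol]) auto
      ultimately have "K 0 \<le> 0" by (simp add: max_def split: if_splits)
      then show ?thesis by (simp add: indicator_def)
    qed (simp add: indicator_def)
    moreover have "(\<integral>\<^sup>+ s. indicator {0<..} s * ennreal (indicator {0<..} (V s)) \<partial>interval_measure K')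
        = (\<integral>\<^sup>+ s. 0 \<partial>interval_measure K')"
    proof (rule nn_integral_cong_AE)
      show "AE s in interval_measure K'. indicator {0<..} s * ennreal (indicator {0<..} (V s)) = 0"
        using AE_interval_measure_not_flat[OF monoK' rcK']
      proof eventually_elim
        case (elim s)
        have "\<not> (0 < s \<and> 0 < V s)"
        proof
          assume s: "0 < s \<and> 0 < V s"
          then have lt: "g (S s) - X s < K s" by (simp add: V_def)
          obtain u where "u > s" "K u = K s" using sol_K_flat[OF sol _ lt] s by auto
          then have "K' u = K' s" using s by (simp add: K'_def)
          \<comment> \<open>A flat piece to the right of s does not yet exclude an atom of dK at s.
            But a jump of K would land on g(S s) - X s, which means V s = 0; so K is left-continuous
            at s.\<close>
          obtain L where L: "(K \<longlongrightarrow> L) (at_left s)" "L \<le> K s" "\<And>r. 0 \<le> r \<Longrightarrow> r < s \<Longrightarrow> K r \<le> L"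
            using mono_on_at_left_limit[OF mono(1)] s by blast
          have "K s \<le> max L (g (S s) - X s)"
            using s L(3) by (intro sol_K_le_left_limit[OF sol]) auto
          then have "L = K s" using L(2) lt by (auto simp: max_def split: if_splits)
          have "eventually (\<lambda>r. K r = K' r) (at_left s)"
            using eventually_at_left_real[of 0 s] s by (auto elim!: eventually_mono simp: K'_def)
          with L(1) have "(K' \<longlongrightarrow> L) (at_left s)" by (rule Lim_transform_eventually)
          then have "continuous (at_left s) K'" using s \<open>L = K s\<close> by (simp add: continuous_within K'_def)
          with elim \<open>u > s\<close> \<open>K' u = K' s\<close> show False by blast
        qed
        then show ?case by (auto simp: indicator_def)
      qed
    qed
    ultimately show ?thesis
      unfolding stieltjes_nn_0_inf_def LS_measure_def K'_def[symmetric, abs_def]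
      by (simp add: ennreal_neg K'_def[abs_def])
  qed
  then have "tax_reflection \<delta> xbar X V K"
    unfolding tax_reflection_def
    using cadlag_V cadlag_sol_K[OF sol] V_nonneg mono(1) sol_K_nonneg[OF sol] tax
    by (auto simp: V_def[abs_def])
  then show ?thesis by (simp add: V_def[abs_def])
qed

text \<open>Separation of variables for the ODE itself, with time as the driving function: the time
  needed to reach the level y r from xbar is the integral of 1/p.\<close>

lemma separation_h:
  assumes "0 \<le> r"
  shows "ennreal r = (\<integral>\<^sup>+x\<in>{xbar<..y r}. ennreal (inverse (p x)) \<partial>lborel)"
proof -
  have "ennreal (r - 0) = (\<integral>\<^sup>+x\<in>{y\<^sub>0 0<..y\<^sub>0 r}. ennreal (inverse (p x)) \<partial>lborel)"
  proof (rule separation_of_variables)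
    fix c assume "0 \<le> c" "c \<le> r"
    then show "ennreal (y\<^sub>0 r - y\<^sub>0 c) = (\<integral>\<^sup>+s\<in>{c<..r}. ennreal (p (y\<^sub>0 s)) \<partial>interval_measure (\<lambda>x. x))"
      using nn_integral_y[of c r] by (simp add: y\<^sub>0_def[of r] y\<^sub>0_def[of c] lborel_eq_real)
  qed (use assms mono_y\<^sub>0 continuous_on_y\<^sub>0 p_range in \<open>auto simp: mono_def\<close>)
  then show ?thesis using assms by (simp add: y\<^sub>0_def y_0)
qed

text \<open>Here V = X + K - g(S) is not given but has to be derived, so the continuity of S cannot
  be taken from the theory of solutions. It is obtained from the tax equation and the
  complementarity of V and K, and it then makes separation of variables applicable to U and
  S.\<close>

lemma tax_reflection_imp_solution:
  assumes tr: "tax_reflection \<delta> xbar X V K"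
  obtains S where "solution K S" "\<And>t. 0 \<le> t \<Longrightarrow> V t = X t + K t - g (S t)"
proof -
  define S where "S = runsup xbar (\<lambda>s. X s + K s)"
  define S' where "S' t = S (max 0 t)" for t
  define K' where "K' t = K (max 0 t)" for t
  have cadlag_V: "cadlag V" and cadlag_K: "cadlag K" and V_nonneg: "\<forall>t\<ge>0. 0 \<le> V t"
    and mono_K: "mono_on {0..} K" and K_0: "0 \<le> K 0"
    and V_eq: "\<And>t. 0 \<le> t \<Longrightarrow> V t = X t + K t - stieltjes_Ioc (\<lambda>s. \<delta> (V s)) S t"
    and V_K: "stieltjes_nn_0_inf (\<lambda>s. indicator {0<..} (V s)) K = 0"
    using tr by (auto simp: tax_reflection_def S_def)
  have K_monoD: "K s \<le> K t" if "0 \<le> s" "s \<le> t" for s t using mono_K that by (auto simp: mono_on_def)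
  have monoK': "mono K'" unfolding K'_def[abs_def] by (rule mono_max0[OF mono_K])
  have rcK': "continuous (at_right t) K'" for t
    unfolding K'_def[abs_def] using cadlag_K by (intro continuous_at_right_max0) (simp add: cadlag_def)
  note [measurable] = cadlag_measurable_max0[OF cadlag_V]

  have bdd: "bdd_above ((\<lambda>s. X s + K s) ` {0..max 0 t})" for t
  proof -
    obtain B where "\<And>s. 0 \<le> s \<Longrightarrow> s \<le> max 0 t \<Longrightarrow> \<bar>X s\<bar> \<le> B"
      using cadlag_bounded[OF cadlag_X, of "max 0 t"] by auto
    then show ?thesis
      using K_monoD by (intro bdd_aboveI2[of _ _ "B + K (max 0 t)"] add_mono) (force simp: abs_le_iff)+
  qed
  have S_ge: "xbar \<le> S t" for t by (simp add: S_def runsup_def)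
  have S_upper: "X s + K s \<le> S t" if "0 \<le> s" "s \<le> t" for s t
    using runsup_upper[OF bdd] that by (simp add: S_def)
  have S_le: "S t \<le> u" if "0 \<le> t" "xbar \<le> u" "\<And>s. 0 \<le> s \<Longrightarrow> s \<le> t \<Longrightarrow> X s + K s \<le> u" for t u
    using runsup_le_iff[OF bdd, of xbar t u] that by (simp add: S_def)
  have S_monoD: "S s \<le> S t" if "0 \<le> s" "s \<le> t" for s t
    using that S_upper S_ge by (intro S_le) auto
  have mono_S: "mono_on {0..} S" using S_monoD by (auto intro: mono_onI)
  have monoS': "mono S'" unfolding S'_def[abs_def] by (rule mono_max0[OF mono_S])
  have M_right: "((\<lambda>s. X s + K s) \<longlongrightarrow> X t + K t) (at_right t)" if "0 \<le> t" for t
    by (intro tendsto_add cadlagD_right cadlag_X cadlag_K that)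
  \<comment> \<open>Used with v slightly above S t for right continuity, and with v = S t for a flat
    piece of S wherever X + K < S.\<close>
  have S_right_le: "\<exists>u>t. S u \<le> v" if t: "0 \<le> t" and v: "S t \<le> v" "X t + K t < v" for t v
  proof -
    have "eventually (\<lambda>s. X s + K s < v) (at_right t)"
      using M_right[OF t] v(2) by (rule order_tendstoD)
    then obtain b where b: "t < b" "\<And>s. t < s \<Longrightarrow> s < b \<Longrightarrow> X s + K s < v"
      by (auto simp: eventually_at_right_field)
    define u where "u = (t + b) / 2"
    have u: "t < u" "u < b" using b(1) by (auto simp: u_def)
    have "S u \<le> v"
    proof (rule S_le)
      fix s assume s: "0 \<le> s" "s \<le> u"
      show "X s + K s \<le> v"
        using S_upper[of s t] v(1) b(2)[of s] s u by (cases "s \<le> t") auto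
    qed (use u t v S_ge[of t] in auto)
    with u show ?thesis by blast
  qed
  have S_right: "(S \<longlongrightarrow> S t) (at_right t)" if t: "0 \<le> t" for t
  proof -
    obtain L where L: "(S \<longlongrightarrow> L) (at_right t)" "S t \<le> L" "\<And>u. t < u \<Longrightarrow> L \<le> S u"
      using mono_on_at_right_limit[OF mono_S t] by blast
    have "L \<le> S t"
    proof (rule field_le_epsilon)
      fix e :: real assume "e > 0"
      then obtain u where "u > t" "S u \<le> S t + e"
        using S_right_le[OF t, of "S t + e"] S_upper[OF t order_refl] by auto
      then show "L \<le> S t + e" using L(3)[of u] by simp
    qed
    with L show ?thesis by simp
  qed
  have rcS': "continuous (at_right t) S'" for t
    unfolding S'_def[abs_def]
    by (intro continuous_at_right_max0) (auto simp: continuous_within S_right)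
  have [measurable]: "S' \<in> borel_measurable borel" using monoS' by (rule borel_measurable_mono)

  have V_0: "V 0 = X 0 + K 0"
    using V_eq[of 0] by (simp add: stieltjes_Ioc_def set_lebesgue_integral_def)
  have K_0_or: "K 0 = 0 \<or> V 0 = 0"
  proof -
    have "ennreal (indicator {0<..} (V 0) * K 0) = 0"
      using V_K by (simp add: stieltjes_nn_0_inf_def)
    then have "indicator {0<..} (V 0) * K 0 \<le> 0" by (simp add: ennreal_eq_0_iff)
    then show ?thesis using K_0 V_nonneg[rule_format, of 0] by (auto simp: indicator_def split: if_splits)
  qed
  \<comment> \<open>Either K 0 = 0 and X 0 <= xbar, or the initial mass of K forces X 0 + K 0 = V 0
    = 0 <= xbar.\<close>
  have S_0: "S 0 = xbar"
  proof (rule antisym[OF S_le S_ge])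
    fix s :: real assume "0 \<le> s" "s \<le> 0"
    then show "X s + K s \<le> xbar" using K_0_or V_0 X_0 xbar_nonneg by auto
  qed auto
  have AE_K: "AE s in interval_measure K'. 0 < s \<longrightarrow> V s = 0"
  proof -
    have "(\<integral>\<^sup>+ s. indicator {0<..} s * ennreal (indicator {0<..} (V s)) \<partial>interval_measure K') = 0"
      using V_K by (simp add: stieltjes_nn_0_inf_def LS_measure_def K'_def[abs_def])
    also have "(\<integral>\<^sup>+ s. indicator {0<..} s * ennreal (indicator {0<..} (V s)) \<partial>interval_measure K')
        = (\<integral>\<^sup>+ s. indicator {0<..} s * ennreal (indicator {0<..} (V (max 0 s))) \<partial>interval_measure K')"
      by (intro nn_integral_cong) (auto simp: indicator_def)
    finally have "AE s in interval_measure K'. indicator {0<..} s * ennreal (indicator {0<..} (V (max 0 s))) = 0"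
      by (subst (asm) nn_integral_0_iff_AE) auto
    then show ?thesis
    proof eventually_elim
      case (elim s)
      then show ?case using V_nonneg[rule_format, of s] by (auto simp: indicator_def split: if_splits)
    qed
  qed

  define D where "D t = (LINT s:{0<..t}|interval_measure S'. \<delta>\<^sub>0 (V (max 0 s)))" for t
  define U where "U t = S t - D t" for t
  have V_U: "V t = X t + K t - S t + U t" if "0 \<le> t" for t
    using V_eq[OF that] unfolding stieltjes_Ioc_\<delta>[OF V_nonneg]
    by (simp add: U_def D_def S'_def[abs_def])
  have U_0: "U 0 = xbar"
    by (simp add: U_def D_def S_0 set_lebesgue_integral_def)
  have U_diff: "ennreal (U t - U c) = (\<integral>\<^sup>+s\<in>{c<..t}. ennreal (p (V (max 0 s))) \<partial>interval_measure S')"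
    and U_monoD: "U c \<le> U t" and U_lipschitz: "U t - U c \<le> S t - S c"
    if ct: "0 \<le> c" "c \<le> t" for c t
  proof -
    note compl = set_integral_interval_measure_complement[OF monoS' rcS', of "\<lambda>s. \<delta>\<^sub>0 (V (max 0 s))"]
    have "{0<..t} = {0<..c} \<union> {c<..t}" using ct by auto
    then have "D t = D c + (LINT s:{c<..t}|interval_measure S'. \<delta>\<^sub>0 (V (max 0 s)))"
      unfolding D_def using \<delta>\<^sub>0_range ct by (simp add: set_integral_Un compl(1))
    then show "ennreal (U t - U c) = (\<integral>\<^sup>+s\<in>{c<..t}. ennreal (p (V (max 0 s))) \<partial>interval_measure S')"
      "U c \<le> U t" "U t - U c \<le> S t - S c"
      using compl(2-4)[of c t] \<delta>\<^sub>0_range ct by (simp_all add: U_def S'_def p_def algebra_simps)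
  qed

  have S_left: "(S \<longlongrightarrow> S t) (at_left t)" if t: "0 < t" for t
  proof -
    obtain Sm where Sm: "(S \<longlongrightarrow> Sm) (at_left t)" "Sm \<le> S t" "\<And>s. 0 \<le> s \<Longrightarrow> s < t \<Longrightarrow> S s \<le> Sm"
      using mono_on_at_left_limit[OF mono_S t] by blast
    obtain Km where Km: "(K \<longlongrightarrow> Km) (at_left t)" "Km \<le> K t" "\<And>s. 0 \<le> s \<Longrightarrow> s < t \<Longrightarrow> K s \<le> Km"
      using mono_on_at_left_limit[OF mono_K t] by blast
    obtain l where l: "(X \<longlongrightarrow> l) (at_left t)" using cadlag_X t unfolding cadlag_def by blast
    have Xl: "X t \<le> l" using no_pos_jumps_X t tendsto_Lim[OF _ l] by (force simp: no_pos_jumps_def)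
    have ev: "eventually (\<lambda>s. 0 \<le> s) (at_left t)"
      using eventually_at_left_real[OF t] by eventually_elim auto
    have lim: "l + Km \<le> Sm"
      by (rule tendsto_le[OF _ Sm(1) tendsto_add[OF l Km(1)]])
         (use ev in \<open>auto elim!: eventually_mono intro: S_upper\<close>)
    \<comment> \<open>A jump of S at t means X + K = S there, hence V t = U t, and it forces K to
      jump, so t is an atom of dK and V t = 0. Thus U t = 0 is not above U 0 = xbar although U is
      nondecreasing, so U is constant on [0, t]. As dU = p(V) dS with p > 0, S is constant there as
      well and cannot have jumped.\<close>
    have "S t = Sm"
    proof (rule ccontr)
      assume "S t \<noteq> Sm"
      then have lt: "Sm < S t" using Sm(2) by simp
      have "S t \<le> max Sm (X t + K t)"
      proof (rule S_le)
        show "xbar \<le> max Sm (X t + K t)" using Sm(3)[of 0] S_ge[of 0] t by simp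
        fix s assume "0 \<le> s" "s \<le> t"
        then show "X s + K s \<le> max Sm (X t + K t)"
          using S_upper[of s s] Sm(3)[of s] by (cases "s = t") auto
      qed (use t in auto)
      with lt have M: "X t + K t = S t" using S_upper[of t t] t by (auto simp: max_def split: if_splits)
      have "V t = 0"
      proof (rule ccontr)
        assume "V t \<noteq> 0"
        have "(K' \<longlongrightarrow> Km) (at_left t)"
          by (rule Lim_transform_eventually[OF Km(1)]) (use ev in \<open>auto elim!: eventually_mono simp: K'_def\<close>)
        from emeasure_interval_measure_singleton[OF monoK' rcK' this]
        have "emeasure (interval_measure K') {t} = ennreal (K t - Km)" using t by (simp add: K'_def)
        moreover have "{t} \<in> null_sets (interval_measure K')"
          by (rule AE_iff_null_sets[THEN iffD2])
             (use AE_K \<open>V t \<noteq> 0\<close> t in \<open>auto elim!: eventually_mono\<close>)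
        ultimately have "K t \<le> Km" by (auto dest: null_setsD1 simp: ennreal_eq_0_iff)
        then show False using M lim Xl lt by simp
      qed
      then have "U t \<le> U 0" using V_U[of t] M t U_0 xbar_nonneg by simp
      then have "(\<integral>\<^sup>+s\<in>{0<..t}. ennreal (p (V (max 0 s))) \<partial>interval_measure S') = 0"
        using U_diff[of 0 t] t by (simp add: ennreal_neg)
      then have "emeasure (interval_measure S') {0<..t} = 0"
        by (rule set_nn_integral_pos_eq_0_imp_null) (use p_range in auto)
      then have "S t \<le> S 0"
        using monoS' rcS' t by (simp add: emeasure_interval_measure_Ioc mono_def ennreal_eq_0_iff S'_def)
      then show False using lt Sm(3)[of 0] t by simp
    qed
    with Sm show ?thesis by simp
  qed
  have "isCont S' t" for t
  proof -
    have "(S' \<longlongrightarrow> S' t) (at_left t)"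
    proof (cases "0 < t")
      case True
      have "eventually (\<lambda>s. S s = S' s) (at_left t)"
        using eventually_at_left_real[OF True] by eventually_elim (auto simp: S'_def)
      then have "(S' \<longlongrightarrow> S t) (at_left t)" by (rule Lim_transform_eventually[OF S_left[OF True]])
      then show ?thesis using True by (simp add: S'_def)
    next
      case False
      then have "eventually (\<lambda>s. S 0 = S' s) (at_left t)"
        unfolding eventually_at_filter by (intro always_eventually) (auto simp: S'_def)
      then have "(S' \<longlongrightarrow> S 0) (at_left t)" by (rule Lim_transform_eventually[OF tendsto_const])
      then show ?thesis using False by (simp add: S'_def)
    qed
    then show ?thesis using rcS'[of t] by (simp add: isCont_def filterlim_split_at continuous_within)
  qed
  then have contS': "continuous_on UNIV S'" by (simp add: continuous_on_eq_continuous_within)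
  have lcS': "continuous (at_left t) S'" for t
    using contS' by (simp add: continuous_on_eq_continuous_within continuous_at_imp_continuous_at_within)

  define U' where "U' t = U (max 0 t)" for t
  have monoU': "mono U'" unfolding U'_def[abs_def]
    by (rule mono_max0) (auto intro: mono_onI U_monoD)
  have contU': "continuous_on UNIV U'"
    unfolding continuous_on_def
  proof (intro ballI)
    fix t :: real
    show "(U' \<longlongrightarrow> U' t) (at t)"
    proof (rule tendstoI)
      fix e :: real assume "e > 0"
      have "(S' \<longlongrightarrow> S' t) (at t)" using contS' by (simp add: continuous_on_def)
      then have "eventually (\<lambda>s. dist (S' s) (S' t) < e) (at t)" using \<open>e > 0\<close> by (rule tendstoD)
      then show "eventually (\<lambda>s. dist (U' s) (U' t) < e) (at t)"
      proof eventually_elim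
        case (elim s)
        moreover have "max 0 s \<le> max 0 t \<or> max 0 t \<le> max 0 s" by linarith
        ultimately show ?case
          using U_lipschitz[of "max 0 s" "max 0 t"] U_lipschitz[of "max 0 t" "max 0 s"]
            U_monoD[of "max 0 s" "max 0 t"] U_monoD[of "max 0 t" "max 0 s"]
          unfolding dist_real_def U'_def S'_def abs_real_def by (auto split: if_splits)
      qed
    qed
  qed
  have U_h: "U t = h (S t)" if t: "0 \<le> t" for t
  proof -
    \<comment> \<open>Separation of variables exhibits S t - xbar as the integral of 1/p from xbar
      to U t; by \<open>separation_h\<close> it is also the integral from xbar to h(S t). A positive
      integrand with finite integral determines its upper limit.\<close>
    have "ennreal (S' t - S' 0) = (\<integral>\<^sup>+x\<in>{U' 0<..U' t}. ennreal (inverse (p x)) \<partial>lborel)"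
    proof (rule separation_of_variables[OF monoS' rcS' monoU' contU'])
      fix c assume c: "0 \<le> c" "c \<le> t"
      have "ennreal (U' t - U' c) = (\<integral>\<^sup>+s\<in>{c<..t}. ennreal (p (V (max 0 s))) \<partial>interval_measure S')"
        using U_diff[OF c] c by (simp add: U'_def)
      also have "\<dots> = (\<integral>\<^sup>+s\<in>{c<..t}. ennreal (p (U' s)) \<partial>interval_measure S')"
      proof (rule nn_integral_cong_AE)
        show "AE s in interval_measure S'. ennreal (p (V (max 0 s))) * indicator {c<..t} s
          = ennreal (p (U' s)) * indicator {c<..t} s"
          using AE_interval_measure_not_flat[OF monoS' rcS']
        proof eventually_elim
          case (elim s)
          show ?case
          proof (cases "s \<in> {c<..t}")
            case True
            then have s: "0 \<le> s" using c by simp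
            have "\<not> X s + K s < S s"
            proof
              assume "X s + K s < S s"
              then obtain u where "u > s" "S u \<le> S s" using S_right_le[OF s, of "S s"] by auto
              then have "S' u = S' s" using s S_monoD[of s u] by (simp add: S'_def)
              with elim lcS' \<open>u > s\<close> show False by blast
            qed
            then have "V s = U s" using V_U[OF s] S_upper[OF s order_refl] by simp
            then show ?thesis using s by (simp add: U'_def)
          qed simp
        qed
      qed
      finally show "ennreal (U' t - U' c) = (\<integral>\<^sup>+s\<in>{c<..t}. ennreal (p (U' s)) \<partial>interval_measure S')" .
    qed (use t p_range in auto)
    then have eq: "ennreal (S t - xbar) = (\<integral>\<^sup>+x\<in>{xbar<..U t}. ennreal (inverse (p x)) \<partial>lborel)"
      using t S_0 U_0 by (simp add: S'_def U'_def)
    have eq': "ennreal (S t - xbar) = (\<integral>\<^sup>+x\<in>{xbar<..h (S t)}. ennreal (inverse (p x)) \<partial>lborel)"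
      using separation_h[of "S t - xbar"] S_ge[of t] by (simp add: h_def)
    show ?thesis
    proof (rule set_nn_integral_Ioc_inject)
      show "(\<integral>\<^sup>+x\<in>{xbar<..U t}. ennreal (inverse (p x)) \<partial>lborel)
          = (\<integral>\<^sup>+x\<in>{xbar<..h (S t)}. ennreal (inverse (p x)) \<partial>lborel)"
        unfolding eq[symmetric] by (rule eq')
      show "(\<integral>\<^sup>+x\<in>{xbar<..U t}. ennreal (inverse (p x)) \<partial>lborel) < \<infinity>"
        unfolding eq[symmetric] by simp
      show "xbar \<le> U t" using U_monoD[of 0 t] t U_0 by simp
      show "xbar \<le> h (S t)" using h_mono[OF order_refl S_ge[of t]] h_xbar by simp
    qed (use p_range in auto)
  qed
  have V_g: "V t = X t + K t - g (S t)" if "0 \<le> t" for t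
    using V_U[OF that] U_h[OF that] by (simp add: g_def)
  have "solution K S"
    unfolding solution_def supersolution_def
  proof (intro allI impI conjI ballI)
    fix T u :: real assume T: "0 \<le> T" "0 \<le> u" and le: "\<forall>s\<in>{0..T}. g (S s) - X s \<le> u"
    \<comment> \<open>dK-almost everywhere V = 0, that is K = g(S) - X <= u. So K can have no growth
      above the level u.\<close>
    have "K' T \<le> u"
    proof (rule AE_interval_measure_le_imp_le[OF monoK' rcK' T(1)])
      show "K' 0 \<le> u"
        using K_0_or V_g[of 0] le[rule_format, of 0] T by (auto simp: K'_def)
      show "AE s in interval_measure K'. s \<in> {0<..T} \<longrightarrow> K' s \<le> u"
        using AE_K
      proof eventually_elim
        case (elim s)
        show ?case
        proof
          assume s: "s \<in> {0<..T}"
          then have "K s = g (S s) - X s" using elim V_g[of s] by simp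
          then show "K' s \<le> u" using le s by (simp add: K'_def)
        qed
      qed
    qed
    then show "K T \<le> u" using T by (simp add: K'_def)
  next
    fix T t :: real assume "t \<in> {0..T}"
    then have t: "0 \<le> t" by simp
    show "0 \<le> K t" using K_monoD[of 0 t] K_0 t by simp
    show "g (S t) - X t \<le> K t" using V_g[OF t] V_nonneg t by force
  qed (use S_le S_ge S_upper mono_K mono_S in \<open>auto intro: mono_on_subset\<close>)
  with V_g show ?thesis by (rule that[rotated]) 
qed

theorem tax_reflection_ex_unique:
  "\<exists>V K. tax_reflection \<delta> xbar X V K \<and>
     (\<forall>V' K'. tax_reflection \<delta> xbar X V' K' \<longrightarrow> (\<forall>t\<ge>0. V' t = V t \<and> K' t = K t))"
proof -
  obtain K S where sol: "solution K S" using ex_solution by blast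
  show ?thesis
  proof (intro exI conjI allI impI)
    show "tax_reflection \<delta> xbar X (\<lambda>t. X t + K t - g (S t)) K"
      by (rule solution_imp_tax_reflection[OF sol])
    fix V' K' and t :: real assume tr: "tax_reflection \<delta> xbar X V' K'" and t: "0 \<le> t"
    obtain S' where S': "solution K' S'" "\<And>t. 0 \<le> t \<Longrightarrow> V' t = X t + K' t - g (S' t)"
      using tax_reflection_imp_solution[OF tr] by blast
    show "K' t = K t" by (rule solution_unique(1)[OF S'(1) sol t])
    then show "V' t = X t + K t - g (S t)"
      using S'(2)[OF t] solution_unique(2)[OF S'(1) sol t] by simp
  qed
qed

end

theorem theorem2p1:
  fixes \<delta> :: "real \<Rightarrow> real"
  assumes meas: "set_borel_measurable borel {0..} \<delta>"
    and range: "\<forall>x\<ge>0. 0 \<le> \<delta> x \<and> \<delta> x < 1"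
    and ode_unique: "\<forall>y0\<ge>0. \<exists>y. ode_solution \<delta> y0 y \<and>
                       (\<forall>z. ode_solution \<delta> y0 z \<longrightarrow> (\<forall>t\<ge>0. z t = y t))"
    and flat: "\<exists>\<epsilon>>0. \<exists>\<gamma>. 0 \<le> \<gamma> \<and> \<gamma> < 1 \<and> (\<forall>x\<in>{0..\<epsilon>}. \<delta> x = \<gamma>)"
  shows "\<forall>X xbar. cadlag X \<and> no_pos_jumps X \<and> xbar \<ge> max (X 0) 0 \<longrightarrow>
           (\<exists>V K. tax_reflection \<delta> xbar X V K \<and>
              (\<forall>V' K'. tax_reflection \<delta> xbar X V' K' \<longrightarrow>
                 (\<forall>t\<ge>0. V' t = V t \<and> K' t = K t)))"
proof (intro allI impI, elim conjE)
  fix X :: "real \<Rightarrow> real" and xbar :: real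
  assume X: "cadlag X" "no_pos_jumps X" "xbar \<ge> max (X 0) 0"
  then obtain y where "ode_solution \<delta> xbar y" using ode_unique by auto
  then interpret tax_setting \<delta> y xbar X
    using meas range X by unfold_locales auto
  show "\<exists>V K. tax_reflection \<delta> xbar X V K \<and>
     (\<forall>V' K'. tax_reflection \<delta> xbar X V' K' \<longrightarrow> (\<forall>t\<ge>0. V' t = V t \<and> K' t = K t))"
    by (rule tax_reflection_ex_unique)
qed

end
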